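(* Let $n\ge 1$ and $A\in M_n(\mathbb{Z})$. Suppose that $\mu$ is a $\times A$-invariant Borel probability measure on $\mathbb{T}^n$ satisfying one of the following: (1) $\mu$ is ergodic (for $T_A$) and there exist an $n$-tuple $(B_1,\dots,B_n)$ of matrices in $M_n(\mathbb{Z})$ strongly independent over $\mathbb{Q}$ and a Følner sequence $\Sigma=\{F_m\}_{m=1}^\infty$ in $\mathbb{N}$ such that $\mu$ is $\times(A^j+B_i)$-invariant for all $j$ in some set $E\subseteq\mathbb{N}$ with $\overline{D}_\Sigma(E)=1$ and all $i=1,\dots,n$; (2) $\mu$ is weakly mixing (for $T_A$) and there exist an $n$-tuple $(B_1,\dots,B_n)$ of matrices in $M_n(\mathbb{Z})$ strongly independent over $\mathbb{Q}$ and a Følner sequence $\Sigma=\{F_m\}_{m=1}^\infty$ in $\mathbb{N}$ such that $\mu$ is $\times(A^j+B_i)$-invariant for all $j$ in some set $E\subseteq\mathbb{N}$ with $\overline{D}_\Sigma(E)>0$ and all $i=1,\dots,n$; (3) $\mu$ is strongly mixing (for $T_A$) and there exist an $n$-tuple $(B_1,\dots,B_n)$ of matrices in $M_n(\mathbb{Z})$ strongly independent over $\mathbb{Q}$ and an infinite set $E\subseteq\mathbb{N}$ such that $\mu$ is $\times(A^j+B_i)$-invariant for all $j\in E$ and all $i=1,\dots,n$. Then $\mu$ is either finitely supported or the Lebesgue (Haar) measure on $\mathbb{T}^n$. Moreover, a $\times A$-invariant Borel probability measure satisfying (2) or (3) is either a Dirac measure or the Lebesgue measure.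
   Context: $\mathbb{N}=\{0,1,2,\dots\}$ and $A^0=I_n$. Identify $\mathbb{T}^n=\{(z_1,\dots,z_n)\in\mathbb{C}^n:|z_i|=1\}$ with $\mathbb{R}^n/\mathbb{Z}^n$ via $(x_1,\dots,x_n)+\mathbb{Z}^n\mapsto(e^{2\pi i x_1},\dots,e^{2\pi i x_n})$. For $C\in M_n(\mathbb{Z})$, the map $T_C:\mathbb{R}^n/\mathbb{Z}^n\to\mathbb{R}^n/\mathbb{Z}^n$ is $T_C(x+\mathbb{Z}^n)=xC+\mathbb{Z}^n$ for row vectors $x\in\mathbb{R}^n$; a Borel probability measure $\mu$ is $\times C$-invariant if $\mu(T_C^{-1}F)=\mu(F)$ for all Borel $F$. A $T$-invariant $\mu$ is ergodic if every Borel $F$ with $T^{-1}F=F$ has $\mu(F)\in\{0,1\}$; weakly mixing if $\mu\times\mu$ is ergodic for $T\times T$; strongly mixing if $\lim_{j\to\infty}\mu(T^{-j}F\cap G)=\mu(F)\mu(G)$ for all Borel $F,G$. A Følner sequence in $\mathbb{N}$ is a sequence $\{F_m\}$ of nonempty finite subsets of $\mathbb{N}$ with $\lim_{m\to\infty}|(F_m+m')\,\Delta\,F_m|/|F_m|=0$ for every $m'\in\mathbb{N}$. For $E\subseteq\mathbb{N}$, $\overline{D}_\Sigma(E)=\limsup_{m\to\infty}|E\cap F_m|/|F_m|$. An $n$-tuple $(B_1,\dots,B_n)$ of $n\times n$ matrices with rational (here integer) entries is strongly independent over $\mathbb{Q}$ if for every nonzero $v\in\mathbb{Q}^{n\times 1}$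 the vectors $B_1v,\dots,B_nv$ are linearly independent over $\mathbb{Q}$. *)

theory Defs
  imports "HOL-Probability.Probability"
begin

text \<open>The torus R^n/Z^n is identified with the fundamental domain [0,1)^n
  (one representative per coset), with its Borel sigma-algebra.\<close>

definition torus_set :: "(real ^ 'n) set" where
  "torus_set = {x. \<forall>i. 0 \<le> x $ i \<and> x $ i < 1}"

definition torus :: "(real ^ 'n) measure" where
  "torus = restrict_space borel torus_set"

definition haar_torus :: "(real ^ 'n) measure" where
  "haar_torus = restrict_space lborel torus_set"

definition mpow :: "int ^ 'n ^ 'n \<Rightarrow> nat \<Rightarrow> int ^ 'n ^ 'n" where
  "mpow A j = ((\<lambda>M. A ** M) ^^ j) (mat 1)"

definition real_mat :: "int ^ 'n ^ 'm \<Rightarrow> real ^ 'n ^ 'm" where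
  "real_mat C = (\<chi> i j. real_of_int (C $ i $ j))"

definition rat_mat :: "int ^ 'n ^ 'm \<Rightarrow> rat ^ 'n ^ 'm" where
  "rat_mat C = (\<chi> i j. rat_of_int (C $ i $ j))"

text \<open>T_C(x + Z^n) = xC + Z^n, x a row vector, on representatives.\<close>
definition T_mat :: "int ^ 'n ^ 'n \<Rightarrow> real ^ 'n \<Rightarrow> real ^ 'n" where
  "T_mat C x = (\<chi> i. frac ((x v* real_mat C) $ i))"

definition invariant :: "'a measure \<Rightarrow> ('a \<Rightarrow> 'a) \<Rightarrow> bool" where
  "invariant M T \<longleftrightarrow> (\<forall>F\<in>sets M. emeasure M (T -` F \<inter> space M) = emeasure M F)"

definition ergodic :: "'a measure \<Rightarrow> ('a \<Rightarrow> 'a) \<Rightarrow> bool" where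
  "ergodic M T \<longleftrightarrow> (\<forall>F\<in>sets M. T -` F \<inter> space M = F \<longrightarrow>
      measure M F = 0 \<or> measure M F = 1)"

definition weakly_mixing :: "'a measure \<Rightarrow> ('a \<Rightarrow> 'a) \<Rightarrow> bool" where
  "weakly_mixing M T \<longleftrightarrow> ergodic (M \<Otimes>\<^sub>M M) (\<lambda>(x, y). (T x, T y))"

definition strongly_mixing :: "'a measure \<Rightarrow> ('a \<Rightarrow> 'a) \<Rightarrow> bool" where
  "strongly_mixing M T \<longleftrightarrow> (\<forall>F\<in>sets M. \<forall>G\<in>sets M.
      (\<lambda>j. measure M ((T ^^ j) -` F \<inter> space M \<inter> G)) \<longlonglongrightarrow> measure M F * measure M G)"

definition folner :: "(nat \<Rightarrow> nat set) \<Rightarrow> bool" where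
  "folner F \<longleftrightarrow> (\<forall>m. finite (F m) \<and> F m \<noteq> {}) \<and>
     (\<forall>m'. (\<lambda>m. real (card (((\<lambda>k. k + m') ` F m) \<union> F m - (((\<lambda>k. k + m') ` F m) \<inter> F m)))
                 / real (card (F m))) \<longlonglongrightarrow> 0)"

definition upper_density :: "(nat \<Rightarrow> nat set) \<Rightarrow> nat set \<Rightarrow> ereal" where
  "upper_density F E = limsup (\<lambda>m. ereal (real (card (E \<inter> F m)) / real (card (F m))))"

definition strongly_independent :: "('n \<Rightarrow> int ^ 'n ^ 'n) \<Rightarrow> bool" where
  "strongly_independent B \<longleftrightarrow> (\<forall>v :: rat ^ 'n. v \<noteq> 0 \<longrightarrow>
     (\<forall>c :: 'n \<Rightarrow> rat. (\<Sum>i\<in>UNIV. c i *s (rat_mat (B i) *v v)) = 0 \<longrightarrow> (\<forall>i. c i = 0)))"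

definition finitely_supported :: "'a measure \<Rightarrow> bool" where
  "finitely_supported M \<longleftrightarrow> (\<exists>S. finite S \<and> S \<in> sets M \<and> emeasure M S = 1)"

end

theory Submission
  imports Defs
begin

text \<open>Write \<open>c k\<close> for the \<open>k\<close>-th Fourier coefficient of \<open>\<mu>\<close> and \<open>e k\<close> for the \<open>k\<close>-th character.
  Pulling \<open>e k\<close> back along \<open>A^j + B i\<close> gives \<open>e k (T_A^j x) * e (B i k) x\<close>, so invariance says that
  this correlation equals \<open>c k\<close> for all \<open>j\<close> in \<open>E\<close>, while mixing (ergodicity: in the mean along
  the Folner sequence) forces it towards \<open>c k * c (B i k)\<close>. Hence \<open>c k = c k * c (B i k)\<close>.
  If all \<open>c k\<close> with \<open>k \<noteq> 0\<close> vanish, \<open>\<mu>\<close> is Haar measure; otherwise \<open>c (B i k) = 1\<close> for some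
  \<open>k \<noteq> 0\<close> and all \<open>i\<close>, so \<open>\<mu>\<close> lives where all the characters \<open>e (B i k)\<close> equal \<open>1\<close>, and by
  independence of the vectors \<open>B i k\<close> this is a finite subgroup.\<close>

subsection \<open>Ergodic measure-preserving maps\<close>

text \<open>The three hypotheses on \<open>E\<close> match three modes in which correlations
  converge. Ergodicity gives convergence of averages only, where deviations of opposite sign may
  cancel; equality on \<open>E\<close> decides the limit because the complement of \<open>E\<close>
  has vanishing share in suitable \<open>F m\<close>. Weak mixing gives convergence in square mean,
  where nothing cancels, so a positive share of \<open>E\<close> decides. Strong mixing gives a
  genuine limit, which every infinite \<open>E\<close> detects. The averages run over an arbitrary
  Folner sequence, so the tool is a mean ergodic theorem, tested against a bounded \<open>g\<close>;
  it rests on the elements of almost minimal norm in a convex hull of the orbit. The square-mean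
  statement is the same theorem for T x T, applied to products f(x) * cnj (f y). For the Dirac
  claim, a finitely supported measure has an atom of some mass p > 0; its return correlations would
  have to approach p^2 in the relevant sense, while they are always 0 or p. The representatives
  [0,1)^n form a non-compact set with opposite faces unglued. Uniqueness of Fourier coefficients is
  therefore proved on the image in C^n and carried back by a Borel inverse.\<close>

locale measure_preserving = prob_space M for M :: "'a measure" +
  fixes T :: "'a \<Rightarrow> 'a"
  assumes measurable_T [measurable]: "T \<in> M \<rightarrow>\<^sub>M M"
    and invariant_T: "invariant M T"
begin

lemma measurable_funpow [measurable]: "T ^^ n \<in> M \<rightarrow>\<^sub>M M"
proof (induction n)
  case (Suc n)
  then show ?case
    using measurable_comp[OF Suc measurable_T] by simp
qed (simp add: measurable_ident_sets id_def)

lemma T_space [simp]: "x \<in> space M \<Longrightarrow> T x \<in> space M"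
  using measurable_T by (rule measurable_space)

lemma funpow_space [simp]: "x \<in> space M \<Longrightarrow> (T ^^ n) x \<in> space M"
  using measurable_funpow by (rule measurable_space)

lemma distr_T: "distr M M T = M"
  by (rule measure_eqI) (use invariant_T in \<open>auto simp: emeasure_distr invariant_def\<close>)

lemma distr_funpow: "distr M M (T ^^ n) = M"
proof (induction n)
  case 0
  then show ?case by (simp add: distr_id2)
next
  case (Suc n)
  have "distr M M (T ^^ Suc n) = distr (distr M M (T ^^ n)) M T"
    by (subst distr_distr) auto
  then show ?case
    by (simp add: Suc.IH distr_T o_def)
qed

lemma integral_funpow:
  fixes f :: "'a \<Rightarrow> 'b :: {banach, second_countable_topology}"
  assumes "f \<in> borel_measurable M"
  shows "(\<integral>x. f ((T ^^ n) x) \<partial>M) = (\<integral>x. f x \<partial>M)"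
  using integral_distr[OF measurable_funpow assms, of n] by (simp add: distr_funpow)

lemmas integral_T = integral_funpow[where n = 1, simplified]

lemma integrable_funpow:
  fixes f :: "'a \<Rightarrow> 'b :: {banach, second_countable_topology}"
  assumes "integrable M f"
  shows "integrable M (\<lambda>x. f ((T ^^ n) x))"
  using integrable_distr[OF measurable_funpow, of n f] assms by (simp add: distr_funpow)

lemma AE_funpow:
  assumes "AE x in M. P x"
  shows "AE x in M. P ((T ^^ n) x)"
proof -
  have "AE x in distr M M (T ^^ n). P x"
    unfolding distr_funpow by (rule assms)
  then show ?thesis
    by (rule AE_distrD[OF measurable_funpow])
qed

lemmas AE_T = AE_funpow[where n = 1, simplified]

lemma integrable_bounded:
  fixes f :: "'a \<Rightarrow> 'b :: {banach, second_countable_topology}"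
  assumes "f \<in> borel_measurable M" "\<And>x. x \<in> space M \<Longrightarrow> norm (f x) \<le> C"
  shows "integrable M f"
  by (rule integrable_const_bound[where B = C]) (use assms in auto)

text \<open>\<open>ergodic\<close> only speaks of sets that are exactly invariant. The set
  \<open>F\<close> of points whose orbit visits \<open>E\<close> infinitely often is exactly
  invariant, since dropping one step of the orbit changes nothing; it agrees with \<open>E\<close>
  almost everywhere, since almost every orbit stays in \<open>E\<close> or outside it
  forever.\<close>

lemma ergodic_AE_invariant_set:
  assumes erg: "ergodic M T" and E [measurable]: "E \<in> sets M"
    and inv: "AE x in M. T x \<in> E \<longleftrightarrow> x \<in> E"
  shows "measure M E = 0 \<or> measure M E = 1"
proof -
  define F where "F = {x \<in> space M. \<exists>\<^sub>F n in sequentially. (T ^^ n) x \<in> E}"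
  have F [measurable]: "F \<in> sets M"
    unfolding F_def frequently_sequentially by measurable
  have "AE x in M. \<forall>n. (T ^^ Suc n) x \<in> E \<longleftrightarrow> (T ^^ n) x \<in> E"
    using AE_funpow[OF inv] by (auto simp: AE_all_countable)
  then have "AE x in M. x \<in> F \<longleftrightarrow> x \<in> E"
  proof (rule AE_mp, intro AE_I2 impI)
    fix x assume x: "x \<in> space M" and "\<forall>n. (T ^^ Suc n) x \<in> E \<longleftrightarrow> (T ^^ n) x \<in> E"
    then have "(T ^^ n) x \<in> E \<longleftrightarrow> x \<in> E" for n
      by (induction n) auto
    then show "x \<in> F \<longleftrightarrow> x \<in> E"
      using x by (simp add: F_def)
  qed
  then have "measure M F = measure M E"
    by (intro measure_eq_AE) auto
  moreover have "(\<exists>\<^sub>F n in sequentially. (T ^^ n) (T x) \<in> E) \<longleftrightarrow> (\<exists>\<^sub>F n in sequentially. (T ^^ n) x \<in> E)" for x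
    unfolding frequently_def
    using eventually_sequentially_Suc[of "\<lambda>n. (T ^^ n) x \<notin> E"] by (simp add: funpow_swap1)
  then have "T -` F \<inter> space M = F"
    by (auto simp: F_def)
  ultimately show ?thesis
    using erg F unfolding ergodic_def by metis
qed

text \<open>One sublevel set is enough, the one at the mean: having measure 0 or 1, it puts
  \<open>P\<close> almost everywhere on one side of its own mean, and then the integral leaves no
  room for a deviation.\<close>

lemma ergodic_AE_invariant_const:
  fixes P :: "'a \<Rightarrow> real"
  assumes erg: "ergodic M T" and P: "integrable M P" and inv: "AE x in M. P (T x) = P x"
  shows "AE x in M. P x = (\<integral>x. P x \<partial>M)"
proof -
  define c where "c = (\<integral>x. P x \<partial>M)"
  have [measurable]: "P \<in> borel_measurable M"
    using P by auto
  have int0: "(\<integral>x. P x - c \<partial>M) = 0" "(\<integral>x. c - P x \<partial>M) = 0"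
    using P by (simp_all add: c_def prob_space)
  let ?E = "{x \<in> space M. P x \<le> c}"
  have [measurable]: "?E \<in> sets M" by measurable
  have "AE x in M. T x \<in> ?E \<longleftrightarrow> x \<in> ?E"
    using inv AE_space by eventually_elim auto
  then have "prob ?E = 0 \<or> prob ?E = 1"
    by (intro ergodic_AE_invariant_set erg) auto
  then have "AE x in M. P x = c"
  proof
    assume "prob ?E = 0"
    then have "AE x in M. x \<notin> ?E"
      by (simp add: prob_eq_0)
    then have *: "AE x in M. 0 \<le> P x - c"
      using AE_space by eventually_elim auto
    have "AE x in M. P x - c = 0"
      using integral_nonneg_eq_0_iff_AE[OF _ *] int0 P by simp
    then show ?thesis by eventually_elim simp
  next
    assume "prob ?E = 1"
    then have "AE x in M. x \<in> ?E"
      by (simp add: prob_eq_1)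
    then have *: "AE x in M. 0 \<le> c - P x"
      by eventually_elim auto
    have "AE x in M. c - P x = 0"
      using integral_nonneg_eq_0_iff_AE[OF _ *] int0 P by simp
    then show ?thesis by eventually_elim simp
  qed
  then show ?thesis by (simp add: c_def)
qed

text \<open>The closure under midpoints and \<open>T\<close> is all that the parallelogram argument below needs
  of the convex hull of the orbit of \<open>f\<close>.\<close>

inductive_set orbit_hull :: "('a \<Rightarrow> real) \<Rightarrow> ('a \<Rightarrow> real) set" for f where
  base: "f \<in> orbit_hull f"
| shift: "u \<in> orbit_hull f \<Longrightarrow> (\<lambda>x. u (T x)) \<in> orbit_hull f"
| mid: "u \<in> orbit_hull f \<Longrightarrow> v \<in> orbit_hull f \<Longrightarrow> (\<lambda>x. (u x + v x) / 2) \<in> orbit_hull f"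

lemma orbit_hull_measurable:
  "u \<in> orbit_hull f \<Longrightarrow> f \<in> borel_measurable M \<Longrightarrow> u \<in> borel_measurable M"
  by (induction rule: orbit_hull.induct) auto

lemma orbit_hull_bounded:
  assumes "u \<in> orbit_hull f" "\<And>x. x \<in> space M \<Longrightarrow> \<bar>f x\<bar> \<le> C"
  shows "x \<in> space M \<Longrightarrow> \<bar>u x\<bar> \<le> C"
  using assms(1)
proof (induction arbitrary: x)
  case (mid u v)
  then have "\<bar>u x\<bar> \<le> C" "\<bar>v x\<bar> \<le> C" by auto
  then show ?case by (auto simp: abs_le_iff)
qed (use assms in auto)

lemma orbit_hull_integral:
  assumes "u \<in> orbit_hull f" "f \<in> borel_measurable M" "\<And>x. x \<in> space M \<Longrightarrow> \<bar>f x\<bar> \<le> C"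
  shows "(\<integral>x. u x \<partial>M) = (\<integral>x. f x \<partial>M)"
  using assms(1)
proof induction
  case (shift u)
  have "u \<in> borel_measurable M"
    using shift.hyps assms(2) by (rule orbit_hull_measurable)
  then show ?case
    unfolding shift.IH[symmetric] by (rule integral_T)
next
  case (mid u v)
  have int: "integrable M w" if "w \<in> orbit_hull f" for w
    using orbit_hull_measurable[OF that assms(2)] orbit_hull_bounded[OF that assms(3)]
    by (intro integrable_bounded[where C = C]) auto
  have "integrable M u" "integrable M v"
    using mid.hyps int by auto
  then show ?case using mid.IH by simp
qed simp

text \<open>A sequence in the hull that minimises the \<open>L\<^sup>2\<close> norm is Cauchy by the parallelogram law, and
  it is asymptotically \<open>T\<close>-invariant because composing with \<open>T\<close> preserves both the hull and the norm;
  so its limit is constant by ergodicity.\<close>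

lemma orbit_hull_approx:
  assumes erg: "ergodic M T" and f [measurable]: "f \<in> borel_measurable M"
    and bdd: "\<And>x. x \<in> space M \<Longrightarrow> \<bar>f x\<bar> \<le> C" and "e > 0"
  shows "\<exists>u\<in>orbit_hull f. (\<integral>x. \<bar>u x - (\<integral>x. f x \<partial>M)\<bar> \<partial>M) < e"
proof -
  define c where "c = (\<integral>x. f x \<partial>M)"
  let ?H = "orbit_hull f"
  have "C \<ge> 0"
    using bdd not_empty by fastforce
  have meas [measurable]: "u \<in> borel_measurable M" if "u \<in> ?H" for u
    using that f by (rule orbit_hull_measurable)
  have hbdd: "\<bar>u x\<bar> \<le> C" if "u \<in> ?H" "x \<in> space M" for u x
    using orbit_hull_bounded[OF that(1) bdd that(2)] by simp
  have int: "integrable M u" if "u \<in> ?H" for u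
    by (rule integrable_bounded[where C = C]) (use that hbdd in auto)
  have intm: "integrable M (\<lambda>x. u x * v x)" if "u \<in> ?H" "v \<in> ?H" for u v
  proof (rule integrable_bounded[where C = "C * C"])
    show "(\<lambda>x. u x * v x) \<in> borel_measurable M"
      using meas that by measurable
    show "norm (u x * v x) \<le> C * C" if "x \<in> space M" for x
      using hbdd \<open>u \<in> ?H\<close> \<open>v \<in> ?H\<close> that \<open>C \<ge> 0\<close> by (simp add: abs_mult mult_mono)
  qed
  have int2: "integrable M (\<lambda>x. (u x - v x)\<^sup>2)" if "u \<in> ?H" "v \<in> ?H" for u v
    using that intm[of u u] intm[of v v] intm[of u v]
    by (simp add: power2_diff power2_eq_square[symmetric] mult.assoc)
  define q where "q u = (\<integral>x. (u x)\<^sup>2 \<partial>M)" for u :: "'a \<Rightarrow> real"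
  define d where "d = Inf (q ` ?H)"
  have q0: "q u \<ge> 0" for u
    by (simp add: q_def)
  have d_le: "d \<le> q u" if "u \<in> ?H" for u
    unfolding d_def using that q0 by (intro cInf_lower bdd_belowI[of _ 0]) auto
  have "\<exists>u\<in>?H. q u < d + inverse (real (Suc n))" for n
    using cInf_lessD[of "q ` ?H" "d + inverse (real (Suc n))"] orbit_hull.base
    by (auto simp: d_def)
  then obtain U where U: "U n \<in> ?H" "q (U n) < d + inverse (real (Suc n))" for n
    by metis
  have par: "(\<integral>x. (u x - v x)\<^sup>2 \<partial>M) \<le> 2 * q u + 2 * q v - 4 * d" if uv: "u \<in> ?H" "v \<in> ?H" for u v
  proof -
    have "(\<integral>x. (u x - v x)\<^sup>2 \<partial>M)
        = (\<integral>x. 2 * (u x)\<^sup>2 + 2 * (v x)\<^sup>2 - 4 * ((u x + v x) / 2)\<^sup>2 \<partial>M)"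
      by (rule Bochner_Integration.integral_cong) (auto simp: power2_eq_square field_simps)
    also have "\<dots> = 2 * q u + 2 * q v - 4 * q (\<lambda>x. (u x + v x) / 2)"
      using intm[OF uv(1) uv(1)] intm[OF uv(2) uv(2)] intm[OF orbit_hull.mid[OF uv] orbit_hull.mid[OF uv]]
      unfolding q_def power2_eq_square by (simp del: times_divide_eq_left times_divide_eq_right)
    finally show ?thesis
      using d_le[OF orbit_hull.mid[OF uv]] by simp
  qed
  \<comment> \<open>Expanding the square of \<open>\<bar>u x - v x\<bar> - t\<close> converts the
    \<open>L^2\<close> bounds into the \<open>L^1\<close> bounds asked for below; the free parameter
    \<open>t\<close> is later set to the target accuracy.\<close>
  have L1: "(\<integral>x. \<bar>u x - v x\<bar> \<partial>M) \<le> (\<integral>x. (u x - v x)\<^sup>2 \<partial>M) / (2 * t) + t / 2"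
    if uv: "u \<in> ?H" "v \<in> ?H" and "t > 0" for u v t
  proof -
    have "(\<integral>x. \<bar>u x - v x\<bar> \<partial>M) \<le> (\<integral>x. (u x - v x)\<^sup>2 / (2 * t) + t / 2 \<partial>M)"
    proof (rule integral_mono)
      fix x
      have "0 \<le> (\<bar>u x - v x\<bar> - t)\<^sup>2" by simp
      also have "\<dots> = (u x - v x)\<^sup>2 + t\<^sup>2 - 2 * t * \<bar>u x - v x\<bar>"
        by (simp add: power2_diff)
      finally show "\<bar>u x - v x\<bar> \<le> (u x - v x)\<^sup>2 / (2 * t) + t / 2"
        using \<open>t > 0\<close> by (simp add: field_simps power2_eq_square)
    qed (use int2 int uv in auto)
    then show ?thesis
      using int2[OF uv] by (simp add: prob_space)
  qed
  have inverse_small: "\<exists>N. \<forall>n\<ge>N. inverse (real (Suc n)) < t" if "t > 0" for t :: real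
    using order_tendstoD(2)[OF LIMSEQ_inverse_real_of_nat that] by (simp add: eventually_sequentially)
  have cauchy: "\<exists>N. \<forall>i\<ge>N. \<forall>j\<ge>N. (\<integral>x. norm (U i x - U j x) \<partial>M) < e" if "e > 0" for e :: real
  proof -
    \<comment> \<open>With both norms within \<open>e^2 / 4\<close> of the infimum,
      \<open>par\<close> gives less than \<open>e^2\<close>, and \<open>L1\<close> at
      \<open>t = e\<close> then gives less than \<open>e / 2 + e / 2\<close>.\<close>
    obtain N where N: "\<And>n. n \<ge> N \<Longrightarrow> inverse (real (Suc n)) < e\<^sup>2 / 4"
      using inverse_small[of "e\<^sup>2 / 4"] \<open>e > 0\<close> by (meson divide_pos_pos zero_less_numeral zero_less_power)
    have "(\<integral>x. norm (U i x - U j x) \<partial>M) < e" if "i \<ge> N" "j \<ge> N" for i j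
    proof -
      have "(\<integral>x. (U i x - U j x)\<^sup>2 \<partial>M) < e\<^sup>2"
        using par[OF U(1) U(1), of i j] U(2)[of i] U(2)[of j] N[OF \<open>i \<ge> N\<close>] N[OF \<open>j \<ge> N\<close>] by linarith
      then have "(\<integral>x. (U i x - U j x)\<^sup>2 \<partial>M) / (2 * e) < e / 2"
        using \<open>e > 0\<close> by (simp add: field_simps power2_eq_square)
      then show ?thesis
        using L1[OF U(1) U(1) \<open>e > 0\<close>, of i j] by simp
    qed
    then show ?thesis by blast
  qed
  \<comment> \<open>Almost everywhere convergence is available only along a subsequence; together
    with the uniform bound \<open>C\<close> it makes dominated convergence applicable to every
    integral below.\<close>
  obtain r where r: "strict_mono r" and AEc: "AE x in M. Cauchy (\<lambda>i. U (r i) x)"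
    by (rule cauchy_L1_AE_cauchy_subseq[of M U, OF int[OF U(1)] cauchy])
  note [measurable] = meas[OF U(1)]
  define P where "P x = lim (\<lambda>i. U (r i) x)" for x
  have P [measurable]: "P \<in> borel_measurable M"
    unfolding P_def by (rule borel_measurable_lim_metric) measurable
  have lim: "AE x in M. (\<lambda>i. U (r i) x) \<longlonglongrightarrow> P x"
    using AEc by eventually_elim (simp add: P_def Cauchy_convergent_iff convergent_LIMSEQ_iff)
  have limT: "AE x in M. (\<lambda>i. U (r i) (T x)) \<longlonglongrightarrow> P (T x)"
    using AE_T[OF lim] .
  have bU: "AE x in M. norm (U (r i) x) \<le> C" for i
    using hbdd[OF U(1)] by auto
  have intP: "integrable M P"
    by (rule integrable_dominated_convergence[where s = "\<lambda>i. U (r i)" and w = "\<lambda>_. C"])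
      (use lim bU in auto)
  have "(\<lambda>i. \<integral>x. U (r i) x \<partial>M) \<longlonglongrightarrow> (\<integral>x. P x \<partial>M)"
    by (rule integral_dominated_convergence[where w = "\<lambda>_. C"]) (use lim bU in auto)
  moreover have "(\<integral>x. U (r i) x \<partial>M) = c" for i
    using orbit_hull_integral[OF U(1) f bdd] by (simp add: c_def)
  ultimately have intPc: "(\<integral>x. P x \<partial>M) = c"
    by (simp add: LIMSEQ_const_iff)
  have "(\<lambda>i. \<integral>x. (U (r i) x - U (r i) (T x))\<^sup>2 \<partial>M) \<longlonglongrightarrow> (\<integral>x. (P x - P (T x))\<^sup>2 \<partial>M)"
    and intPT: "integrable M (\<lambda>x. (P x - P (T x))\<^sup>2)"
  proof -
    have 1: "AE x in M. (\<lambda>i. (U (r i) x - U (r i) (T x))\<^sup>2) \<longlonglongrightarrow> (P x - P (T x))\<^sup>2"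
      using lim limT by eventually_elim (intro tendsto_intros)
    have 2: "AE x in M. norm ((U (r i) x - U (r i) (T x))\<^sup>2) \<le> (2 * C)\<^sup>2" for i
    proof (rule AE_I2)
      fix x assume "x \<in> space M"
      then have "\<bar>U (r i) x - U (r i) (T x)\<bar> \<le> \<bar>2 * C\<bar>"
        using hbdd[OF U(1), of x "r i"] hbdd[OF U(1), of "T x" "r i"] by auto
      then show "norm ((U (r i) x - U (r i) (T x))\<^sup>2) \<le> (2 * C)\<^sup>2"
        by (simp add: abs_le_square_iff)
    qed
    show "(\<lambda>i. \<integral>x. (U (r i) x - U (r i) (T x))\<^sup>2 \<partial>M) \<longlonglongrightarrow> (\<integral>x. (P x - P (T x))\<^sup>2 \<partial>M)"
      by (rule integral_dominated_convergence[where w = "\<lambda>_. (2 * C)\<^sup>2"]) (use 1 2 in auto)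
    show "integrable M (\<lambda>x. (P x - P (T x))\<^sup>2)"
      by (rule integrable_dominated_convergence[where w = "\<lambda>_. (2 * C)\<^sup>2" and s = "\<lambda>i x. (U (r i) x - U (r i) (T x))\<^sup>2"])
        (use 1 2 in auto)
  qed
  moreover have "(\<lambda>i. \<integral>x. (U (r i) x - U (r i) (T x))\<^sup>2 \<partial>M) \<longlonglongrightarrow> 0"
  proof (rule tendsto_sandwich[where f = "\<lambda>_. 0" and h = "\<lambda>i. 4 * inverse (real (Suc (r i)))"])
    have "(\<integral>x. (U i x - U i (T x))\<^sup>2 \<partial>M) \<le> 4 * inverse (real (Suc i))" for i
    proof -
      \<comment> \<open>Since both functions have the same norm, \<open>par\<close> bounds their
        squared distance by \<open>4 * (q (U i) - d)\<close>, which explains the factor 4.\<close>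
      have "q (\<lambda>x. U i (T x)) = q (U i)"
        unfolding q_def by (subst integral_T[symmetric, where f = "\<lambda>x. (U i x)\<^sup>2"]) auto
      then show ?thesis
        using par[OF U(1) orbit_hull.shift[OF U(1)], of i i] U(2)[of i] by simp
    qed
    then show "\<forall>\<^sub>F i in sequentially. (\<integral>x. (U (r i) x - U (r i) (T x))\<^sup>2 \<partial>M) \<le> 4 * inverse (real (Suc (r i)))"
      by auto
    show "(\<lambda>i. 4 * inverse (real (Suc (r i)))) \<longlonglongrightarrow> 0"
      using tendsto_mult_right[OF LIMSEQ_subseq_LIMSEQ[OF LIMSEQ_inverse_real_of_nat r], of 4]
      by (simp add: o_def)
  qed auto
  ultimately have "(\<integral>x. (P x - P (T x))\<^sup>2 \<partial>M) = 0"
    using LIMSEQ_unique by blast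
  then have "AE x in M. (P x - P (T x))\<^sup>2 = 0"
    using integral_nonneg_eq_0_iff_AE[OF intPT] by simp
  then have "AE x in M. P (T x) = P x"
    by eventually_elim simp
  then have Pc: "AE x in M. P x = c"
    using ergodic_AE_invariant_const[OF erg intP] intPc by simp
  have "(\<lambda>i. \<integral>x. \<bar>U (r i) x - c\<bar> \<partial>M) \<longlonglongrightarrow> (\<integral>x. 0 \<partial>M)"
  proof (rule integral_dominated_convergence[where w = "\<lambda>_. C + \<bar>c\<bar>"])
    show "AE x in M. (\<lambda>i. \<bar>U (r i) x - c\<bar>) \<longlonglongrightarrow> 0"
      using lim Pc by eventually_elim (auto intro!: tendsto_eq_intros)
    show "AE x in M. norm \<bar>U (r i) x - c\<bar> \<le> C + \<bar>c\<bar>" for i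
      using bU[of i] by eventually_elim auto
  qed auto
  then have "(\<lambda>i. \<integral>x. \<bar>U (r i) x - c\<bar> \<partial>M) \<longlonglongrightarrow> 0"
    by (simp only: Bochner_Integration.integral_zero)
  from order_tendstoD(2)[OF this \<open>e > 0\<close>]
  obtain i where "(\<integral>x. \<bar>U (r i) x - c\<bar> \<partial>M) < e"
    unfolding eventually_sequentially by blast
  then show ?thesis
    using U(1) unfolding c_def by blast
qed

end

subsection \<open>Averages along Folner sequences\<close>

text \<open>Vector-valued, because it is used both for complex correlations and for real squared
  deviations.\<close>

definition avg :: "nat set \<Rightarrow> (nat \<Rightarrow> 'b :: real_normed_vector) \<Rightarrow> 'b" where
  "avg F c = (\<Sum>j\<in>F. c j) /\<^sub>R real (card F)"

lemma avg_add: "avg F (\<lambda>j. a j + b j) = avg F a + avg F b"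
  and avg_diff: "avg F (\<lambda>j. a j - b j) = avg F a - avg F b"
  by (simp_all add: avg_def sum.distrib sum_subtractf algebra_simps)

lemma avg_bounded_linear:
  assumes "bounded_linear L"
  shows "avg F (\<lambda>j. L (c j)) = L (avg F c)"
proof -
  interpret L: bounded_linear L by fact
  show ?thesis by (simp add: avg_def L.sum L.scaleR)
qed

lemma avg_const: "finite F \<Longrightarrow> F \<noteq> {} \<Longrightarrow> avg F (\<lambda>_. c) = c"
  by (simp add: avg_def scaleR_conv_of_real sum_constant_scaleR card_eq_0_iff)

lemma norm_avg_le:
  assumes "finite F" "F \<noteq> {}" "\<And>j. j \<in> F \<Longrightarrow> norm (c j) \<le> C"
  shows "norm (avg F c) \<le> C"
proof -
  have "norm (avg F c) = norm (\<Sum>j\<in>F. c j) / real (card F)"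
    by (simp add: avg_def divide_inverse mult.commute)
  also have "\<dots> \<le> (\<Sum>j\<in>F. C) / real (card F)"
    by (intro divide_right_mono order_trans[OF norm_sum] sum_mono assms) auto
  also have "\<dots> = C"
    using assms by (simp add: card_eq_0_iff)
  finally show ?thesis .
qed

lemma folner_finite: "folner F \<Longrightarrow> finite (F m)" "folner F \<Longrightarrow> F m \<noteq> {}"
  by (simp_all add: folner_def)

text \<open>After reindexing, the two sums run over \<open>F m + 1\<close> and \<open>F m\<close>,
  and everything outside their symmetric difference cancels. A shift by one is what the rule
  \<open>shift\<close> of \<open>orbit_hull\<close> produces.\<close>

lemma folner_avg_shift:
  fixes c :: "nat \<Rightarrow> 'b :: real_normed_vector"
  assumes F: "folner F" and c: "\<And>j. norm (c j) \<le> C"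
  shows "(\<lambda>m. avg (F m) (\<lambda>j. c (Suc j)) - avg (F m) c) \<longlonglongrightarrow> 0"
proof (rule Lim_null_comparison)
  define S where "S m = (\<lambda>k. k + 1) ` F m" for m
  define D where "D m = S m \<union> F m - (S m \<inter> F m)" for m
  note [simp] = folner_finite[OF F]
  have [simp]: "finite (S m)" for m
    by (simp add: S_def)
  have "norm (avg (F m) (\<lambda>j. c (Suc j)) - avg (F m) c) \<le> C * (real (card (D m)) / real (card (F m)))" for m
  proof -
    have "(\<Sum>j\<in>F m. c (Suc j)) = (\<Sum>j\<in>S m. c j)"
      unfolding S_def by (subst sum.reindex) (auto simp: inj_on_def)
    also have "\<dots> - (\<Sum>j\<in>F m. c j) = (\<Sum>j\<in>S m - F m. c j) - (\<Sum>j\<in>F m - S m. c j)"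
      using sum.Int_Diff[of "S m" c "F m"] sum.Int_Diff[of "F m" c "S m"]
      by (simp add: Int_commute)
    also have "norm \<dots> \<le> (\<Sum>j\<in>S m - F m. norm (c j)) + (\<Sum>j\<in>F m - S m. norm (c j))"
      by (intro order_trans[OF norm_triangle_ineq4] add_mono norm_sum)
    also have "\<dots> = (\<Sum>j\<in>D m. norm (c j))"
      by (subst sum.union_disjoint[symmetric]) (auto simp: D_def intro!: sum.cong)
    also have "\<dots> \<le> C * real (card (D m))"
      using sum_bounded_above[of "D m" "\<lambda>j. norm (c j)" C] c by (simp add: mult.commute)
    finally have "norm ((\<Sum>j\<in>F m. c (Suc j)) - (\<Sum>j\<in>F m. c j)) \<le> C * real (card (D m))" .
    then show ?thesis
      using divide_right_mono[of _ _ "real (card (F m))"]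
      by (fastforce simp: avg_def scaleR_diff_right[symmetric] divide_inverse mult_ac)
  qed
  then show "\<forall>\<^sub>F m in sequentially. norm (avg (F m) (\<lambda>j. c (Suc j)) - avg (F m) c)
      \<le> C * (real (card (D m)) / real (card (F m)))"
    by simp
  have "(\<lambda>m. real (card (D m)) / real (card (F m))) \<longlonglongrightarrow> 0"
    using F unfolding folner_def D_def S_def by blast
  then show "(\<lambda>m. C * (real (card (D m)) / real (card (F m)))) \<longlonglongrightarrow> 0"
    by (rule tendsto_mult_right_zero)
qed

text \<open>A Markov bound: each \<open>j\<close> in \<open>E\<close> contributes the same
  \<open>d > 0\<close> to the average, so the share of \<open>E\<close> in \<open>F m\<close> is at
  most the average divided by \<open>d\<close> and would tend to 0.\<close>

lemma upper_density_pos_eqI: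
  fixes c :: "nat \<Rightarrow> 'b :: real_normed_vector"
  assumes F: "folner F" and E: "upper_density F E > 0" "\<And>j. j \<in> E \<Longrightarrow> c j = h"
    and lim: "(\<lambda>m. avg (F m) (\<lambda>j. (norm (c j - l))\<^sup>2)) \<longlonglongrightarrow> 0"
  shows "h = l"
proof (rule ccontr)
  assume "h \<noteq> l"
  define d where "d = (norm (h - l))\<^sup>2"
  define r where "r m = real (card (E \<inter> F m)) / real (card (F m))" for m
  have "d > 0" using \<open>h \<noteq> l\<close> by (simp add: d_def)
  note [simp] = folner_finite[OF F]
  have "r m \<le> avg (F m) (\<lambda>j. (norm (c j - l))\<^sup>2) / d" for m
  proof -
    have "d * real (card (E \<inter> F m)) = (\<Sum>j\<in>E \<inter> F m. (norm (c j - l))\<^sup>2)"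
      by (simp add: E(2) d_def)
    also have "\<dots> \<le> (\<Sum>j\<in>F m. (norm (c j - l))\<^sup>2)"
      by (rule sum_mono2) auto
    finally have "d * r m \<le> avg (F m) (\<lambda>j. (norm (c j - l))\<^sup>2)"
      by (simp add: r_def avg_def field_simps divide_right_mono)
    then show ?thesis using \<open>d > 0\<close> by (simp add: field_simps)
  qed
  moreover have "(\<lambda>m. avg (F m) (\<lambda>j. (norm (c j - l))\<^sup>2) / d) \<longlonglongrightarrow> 0"
    using tendsto_divide_zero[OF lim] .
  ultimately have "r \<longlonglongrightarrow> 0"
    by (intro tendsto_sandwich[of "\<lambda>_. 0" r sequentially "\<lambda>m. avg (F m) (\<lambda>j. (norm (c j - l))\<^sup>2) / d"])
      (auto simp: r_def)
  then have "(\<lambda>m. ereal (r m)) \<longlonglongrightarrow> ereal 0"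
    by simp
  then have "upper_density F E = 0"
    unfolding upper_density_def r_def[symmetric]
    by (simp add: lim_imp_Limsup zero_ereal_def)
  then show False using E by simp
qed

text \<open>Only indices outside \<open>E\<close> move the average away from \<open>h\<close>, so
  its distance from \<open>h\<close> is at most a constant times their share in \<open>F m\<close>.
  If the limit were not \<open>h\<close>, that share would stay bounded away from 0, contradicting
  density 1.\<close>

lemma upper_density_one_eqI:
  fixes c :: "nat \<Rightarrow> 'b :: real_normed_vector"
  assumes F: "folner F" and E: "upper_density F E = 1" "\<And>j. j \<in> E \<Longrightarrow> c j = h"
    and c: "\<And>j. norm (c j) \<le> C" and lim: "(\<lambda>m. avg (F m) c) \<longlonglongrightarrow> l"
  shows "h = l"
proof (rule ccontr)
  assume "h \<noteq> l"
  define d where "d = norm (l - h)"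
  \<comment> \<open>Bounds \<open>norm (c j - h)\<close>; the summand 1 keeps \<open>K\<close>
    positive for the later division.\<close>
  define K where "K = C + norm h + 1"
  define r where "r m = real (card (E \<inter> F m)) / real (card (F m))" for m
  have "d > 0" using \<open>h \<noteq> l\<close> by (simp add: d_def)
  have "C \<ge> 0" using c[of 0] norm_ge_zero order_trans by blast
  then have "K > 0" unfolding K_def by (smt (verit) norm_ge_zero)
  note [simp] = folner_finite[OF F]
  have le: "norm (avg (F m) c - h) \<le> K * (1 - r m)" for m
  proof -
    have "avg (F m) c - h = avg (F m) (\<lambda>j. c j - h)"
      by (simp add: avg_diff avg_const)
    also have "\<dots> = (\<Sum>j\<in>F m - E. c j - h) /\<^sub>R real (card (F m))"
      unfolding avg_def by (intro arg_cong2[of _ _ _ _ scaleR] refl sum.mono_neutral_right) (auto simp: E(2))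
    also have "norm \<dots> \<le> real (card (F m - E)) * K / real (card (F m))"
    proof -
      have "norm (\<Sum>j\<in>F m - E. c j - h) \<le> real (card (F m - E)) * K"
      proof (rule sum_norm_bound)
        fix j assume "j \<in> F m - E"
        show "norm (c j - h) \<le> K"
          using norm_triangle_ineq4[of "c j" h] c[of j] by (simp add: K_def)
      qed
      then show ?thesis
        by (simp add: divide_inverse mult.commute mult_left_mono)
    qed
    also have "real (card (F m - E)) = real (card (F m)) - real (card (E \<inter> F m))"
      using card_Int_Diff[of "F m" E] by (simp add: Int_commute)
    also have "\<dots> * K / real (card (F m)) = K * (1 - r m)"
      by (simp add: r_def field_simps card_eq_0_iff)
    finally show ?thesis .
  qed
  have "(\<lambda>m. norm (avg (F m) c - h)) \<longlonglongrightarrow> d"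
    unfolding d_def by (intro tendsto_intros lim)
  then have "\<forall>\<^sub>F m in sequentially. norm (avg (F m) c - h) > d / 2"
    using \<open>d > 0\<close> by (intro order_tendstoD(1)) auto
  then have "\<forall>\<^sub>F m in sequentially. ereal (r m) \<le> ereal (1 - d / (2 * K))"
  proof eventually_elim
    case (elim m)
    then have "d / 2 < K * (1 - r m)" using le[of m] by linarith
    then show ?case using \<open>K > 0\<close> by (simp add: field_simps)
  qed
  then have "upper_density F E \<le> ereal (1 - d / (2 * K))"
    unfolding upper_density_def r_def[symmetric] by (rule Limsup_bounded)
  then show False
    using E(1) \<open>d > 0\<close> \<open>K > 0\<close> by (simp add: one_ereal_def field_simps)
qed

section \<open>Correlations and the mean ergodic theorem along Folner sequences\<close>

context measure_preserving
begin

text \<open>There is no conjugate on \<open>g\<close>: for two characters the integrand is then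
  again a character, with the frequencies added.\<close>

definition correlation :: "('a \<Rightarrow> complex) \<Rightarrow> ('a \<Rightarrow> complex) \<Rightarrow> nat \<Rightarrow> complex" where
  "correlation f g j = (\<integral>x. f ((T ^^ j) x) * g x \<partial>M)"

lemma integrable_correlation:
  fixes f g :: "'a \<Rightarrow> complex"
  assumes "integrable M f" and [measurable]: "g \<in> borel_measurable M"
    and g: "\<And>x. x \<in> space M \<Longrightarrow> norm (g x) \<le> K"
  shows "integrable M (\<lambda>x. f ((T ^^ j) x) * g x)"
proof (rule Bochner_Integration.integrable_bound)
  have [measurable]: "f \<in> borel_measurable M"
    using assms(1) by auto
  show "(\<lambda>x. f ((T ^^ j) x) * g x) \<in> borel_measurable M"
    by measurable
  show "integrable M (\<lambda>x. norm (f ((T ^^ j) x)) * K)"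
    using integrable_funpow[OF assms(1)] by simp
  show "AE x in M. norm (f ((T ^^ j) x) * g x) \<le> norm (norm (f ((T ^^ j) x)) * K)"
    using g by (intro AE_I2) (force simp: norm_mult abs_mult intro!: mult_left_mono)
qed

text \<open>The \<open>L^1\<close> norm of \<open>f\<close> is unchanged under
  \<open>T ^^ j\<close>, so the bound is uniform in \<open>j\<close>. This is what allows
  \<open>f\<close> to be replaced by an \<open>L^1\<close> approximation before any limit in
  \<open>j\<close> is taken.\<close>

lemma norm_correlation_le:
  fixes f g :: "'a \<Rightarrow> complex"
  assumes f_meas [measurable]: "f \<in> borel_measurable M" and "integrable M f"
    and g_meas [measurable]: "g \<in> borel_measurable M"
    and g: "\<And>x. x \<in> space M \<Longrightarrow> norm (g x) \<le> K"
  shows "norm (correlation f g j) \<le> K * (\<integral>x. norm (f x) \<partial>M)"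
proof -
  have "norm (f ((T ^^ j) x) * g x) \<le> norm (f ((T ^^ j) x)) * K" if "x \<in> space M" for x
    using g[OF that] by (simp add: norm_mult mult_left_mono)
  then have "norm (correlation f g j) \<le> (\<integral>x. norm (f ((T ^^ j) x)) * K \<partial>M)"
    unfolding correlation_def using integrable_funpow[OF assms(2), of j]
    by (intro order_trans[OF integral_norm_bound integral_mono] integrable_norm
        integrable_correlation[OF assms(2) g_meas g]) auto
  also have "\<dots> = K * (\<integral>x. norm (f x) \<partial>M)"
    using integral_funpow[of "\<lambda>x. norm (f x)" j] by simp
  finally show ?thesis .
qed

text \<open>Composing \<open>u\<close> with \<open>T\<close> advances the correlation by one index,
  which \<open>folner_avg_shift\<close> makes negligible, and midpoints are handled by linearity.
  Hence the whole hull of \<open>f\<close> shares the asymptotic averages of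
  \<open>f\<close>.\<close>

lemma orbit_hull_avg:
  assumes F: "folner F" and u: "u \<in> orbit_hull f"
    and f [measurable]: "f \<in> borel_measurable M" and fb: "\<And>x. x \<in> space M \<Longrightarrow> \<bar>f x\<bar> \<le> C"
    and g [measurable]: "g \<in> borel_measurable M" and gb: "\<And>x. x \<in> space M \<Longrightarrow> norm (g x) \<le> K"
  shows "(\<lambda>m. avg (F m) (correlation (\<lambda>x. complex_of_real (u x)) g)
     - avg (F m) (correlation (\<lambda>x. complex_of_real (f x)) g)) \<longlonglongrightarrow> 0"
proof -
  let ?c = "\<lambda>u. correlation (\<lambda>x. complex_of_real (u x)) g"
  have meas: "w \<in> borel_measurable M" and bdd: "x \<in> space M \<Longrightarrow> norm (complex_of_real (w x)) \<le> C"
    if "w \<in> orbit_hull f" for w x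
    using orbit_hull_measurable[OF that f] orbit_hull_bounded[OF that fb] by auto
  show ?thesis
    using u
  proof induction
    case (shift u)
    have [measurable]: "u \<in> borel_measurable M"
      using meas shift.hyps .
    have int: "integrable M (\<lambda>x. complex_of_real (u x))"
      by (rule integrable_bounded[where C = C]) (use bdd[OF shift.hyps] in auto)
    have "(\<lambda>m. avg (F m) (\<lambda>j. ?c u (Suc j)) - avg (F m) (?c u)) \<longlonglongrightarrow> 0"
      by (rule folner_avg_shift[OF F norm_correlation_le[OF _ int g gb]]) auto
    moreover have "?c u (Suc j) = ?c (\<lambda>x. u (T x)) j" for j
      by (simp add: correlation_def)
    ultimately show ?case
      using tendsto_add[OF _ shift.IH] by fastforce
  next
    case (mid u v)
    have half: "?c (\<lambda>x. (u x + v x) / 2) = (\<lambda>j. (1 / 2) * (?c u j + ?c v j))"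
    proof
      fix j
      have "integrable M (\<lambda>x. complex_of_real (w ((T ^^ j) x)) * g x)" if "w \<in> orbit_hull f" for w
        by (rule integrable_correlation[of "\<lambda>x. complex_of_real (w x)", OF integrable_bounded[OF _ bdd[OF that]] g gb])
          (use meas[OF that] in auto)
      from this[OF mid.hyps(1)] this[OF mid.hyps(2)]
      show "?c (\<lambda>x. (u x + v x) / 2) j = (1 / 2) * (?c u j + ?c v j)"
        by (simp add: correlation_def distrib_right flip: Bochner_Integration.integral_add)
    qed
    have "avg (F m) (?c (\<lambda>x. (u x + v x) / 2)) = (1 / 2) * (avg (F m) (?c u) + avg (F m) (?c v))" for m
      using avg_bounded_linear[OF bounded_linear_mult_right[of "1 / 2"], of "F m" "\<lambda>j. ?c u j + ?c v j"]
      unfolding half by (simp add: avg_add)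
    moreover have "(\<lambda>m. (1 / 2) * ((avg (F m) (?c u) - avg (F m) (?c f)) + (avg (F m) (?c v) - avg (F m) (?c f)))) \<longlonglongrightarrow> 0"
      by (intro tendsto_mult_right_zero tendsto_add_zero mid.IH)
    ultimately show ?case
      by (simp add: algebra_simps)
  qed simp
qed

text \<open>For a hull element \<open>u\<close> close to the constant \<open>c\<close>, every single
  correlation is close to the claimed limit, hence so are all averages; passing from
  \<open>u\<close> back to \<open>f\<close> costs nothing in the limit.\<close>

lemma mean_ergodic_real:
  assumes erg: "ergodic M T" and F: "folner F"
    and f [measurable]: "f \<in> borel_measurable M" and fb: "\<And>x. x \<in> space M \<Longrightarrow> \<bar>f x\<bar> \<le> C"
    and g [measurable]: "g \<in> borel_measurable M" and gb: "\<And>x. x \<in> space M \<Longrightarrow> norm (g x) \<le> K"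
  shows "(\<lambda>m. avg (F m) (correlation (\<lambda>x. complex_of_real (f x)) g))
    \<longlonglongrightarrow> complex_of_real (\<integral>x. f x \<partial>M) * (\<integral>x. g x \<partial>M)"
proof (rule tendstoI)
  fix e :: real assume "e > 0"
  define c where "c = (\<integral>x. f x \<partial>M)"
  let ?c = "\<lambda>u. correlation (\<lambda>x. complex_of_real (u x)) g"
  have "K \<ge> 0"
    using gb not_empty norm_ge_zero order_trans by blast
  note [simp] = folner_finite[OF F]
  \<comment> \<open>This accuracy times \<open>K\<close> is at most \<open>e / 2\<close>; the
    summand 1 covers \<open>K = 0\<close>.\<close>
  obtain u where u: "u \<in> orbit_hull f" and small: "(\<integral>x. \<bar>u x - c\<bar> \<partial>M) < e / (2 * (K + 1))"
    using orbit_hull_approx[OF erg f fb, of "e / (2 * (K + 1))"] \<open>e > 0\<close> \<open>K \<ge> 0\<close>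
    unfolding c_def by auto
  have [measurable]: "u \<in> borel_measurable M"
    using u f by (rule orbit_hull_measurable)
  have ub: "norm (complex_of_real (u x)) \<le> C" if "x \<in> space M" for x
    using orbit_hull_bounded[OF u fb that] by simp
  have intu: "integrable M (\<lambda>x. complex_of_real (u x))"
    by (rule integrable_bounded[OF _ ub]) auto
  have intg: "integrable M g"
    by (rule integrable_bounded[OF g gb])
  have "norm (?c u j - c * (\<integral>x. g x \<partial>M)) \<le> e / 2" for j
  proof -
    have "?c u j - c * (\<integral>x. g x \<partial>M) = correlation (\<lambda>x. complex_of_real (u x - c)) g j"
      using intg integrable_correlation[OF intu g gb, of j]
      by (simp add: correlation_def left_diff_distrib)
    also have "norm \<dots> \<le> K * (\<integral>x. norm (complex_of_real (u x - c)) \<partial>M)"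
      by (rule norm_correlation_le) (use intu gb in auto)
    also have "\<dots> = K * (\<integral>x. \<bar>u x - c\<bar> \<partial>M)"
      by (simp only: norm_of_real)
    also have "\<dots> \<le> K * (e / (2 * (K + 1)))"
      using small \<open>K \<ge> 0\<close> by (intro mult_left_mono) auto
    also have "\<dots> \<le> e / 2"
      using \<open>K \<ge> 0\<close> \<open>e > 0\<close> by (simp add: field_simps)
    finally show ?thesis .
  qed
  then have "norm (avg (F m) (\<lambda>j. ?c u j - c * (\<integral>x. g x \<partial>M))) \<le> e / 2" for m
    by (intro norm_avg_le) auto
  then have near: "norm (avg (F m) (?c u) - c * (\<integral>x. g x \<partial>M)) \<le> e / 2" for m
    by (simp add: avg_diff avg_const)
  have "\<forall>\<^sub>F m in sequentially. norm (avg (F m) (?c u) - avg (F m) (?c f)) < e / 2"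
    using tendstoD[OF orbit_hull_avg[OF F u f fb g gb], of "e / 2"] \<open>e > 0\<close> by (simp add: dist_norm)
  then show "\<forall>\<^sub>F m in sequentially. dist (avg (F m) (?c f)) (complex_of_real (\<integral>x. f x \<partial>M) * (\<integral>x. g x \<partial>M)) < e"
  proof eventually_elim
    case (elim m)
    have "avg (F m) (?c f) - c * (\<integral>x. g x \<partial>M)
        = (avg (F m) (?c u) - c * (\<integral>x. g x \<partial>M)) - (avg (F m) (?c u) - avg (F m) (?c f))"
      by simp
    then have "norm (avg (F m) (?c f) - c * (\<integral>x. g x \<partial>M))
        \<le> norm (avg (F m) (?c u) - c * (\<integral>x. g x \<partial>M)) + norm (avg (F m) (?c u) - avg (F m) (?c f))"
      by (metis norm_triangle_ineq4)
    then show ?case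
      using elim near[of m] by (simp add: dist_norm c_def)
  qed
qed

text \<open>The hull argument concerns real functions; correlations are complex linear in
  \<open>f\<close>, so it is applied to the real and imaginary parts.\<close>

lemma mean_ergodic:
  assumes erg: "ergodic M T" and F: "folner F"
    and f [measurable]: "f \<in> borel_measurable M" and fb: "\<And>x. x \<in> space M \<Longrightarrow> norm (f x) \<le> C"
    and g [measurable]: "g \<in> borel_measurable M" and gb: "\<And>x. x \<in> space M \<Longrightarrow> norm (g x) \<le> K"
  shows "(\<lambda>m. avg (F m) (correlation f g)) \<longlonglongrightarrow> (\<integral>x. f x \<partial>M) * (\<integral>x. g x \<partial>M)"
proof -
  let ?c = "\<lambda>u. correlation (\<lambda>x. complex_of_real (u x)) g"
  have b: "\<bar>Re (f x)\<bar> \<le> C" "\<bar>Im (f x)\<bar> \<le> C" if "x \<in> space M" for x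
    using fb[OF that] abs_Re_le_cmod[of "f x"] abs_Im_le_cmod[of "f x"] by linarith+
  have split: "correlation f g = (\<lambda>j. ?c (\<lambda>x. Re (f x)) j + \<i> * ?c (\<lambda>x. Im (f x)) j)"
  proof
    fix j
    have "correlation f g j
        = (\<integral>x. complex_of_real (Re (f ((T ^^ j) x))) * g x
             + \<i> * (complex_of_real (Im (f ((T ^^ j) x))) * g x) \<partial>M)"
      unfolding correlation_def
    proof (rule Bochner_Integration.integral_cong)
      fix x
      show "f ((T ^^ j) x) * g x = complex_of_real (Re (f ((T ^^ j) x))) * g x
             + \<i> * (complex_of_real (Im (f ((T ^^ j) x))) * g x)"
        by (subst complex_eq[of "f ((T ^^ j) x)"]) (simp add: algebra_simps)
    qed simp
    also have "\<dots> = ?c (\<lambda>x. Re (f x)) j + \<i> * ?c (\<lambda>x. Im (f x)) j"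
      unfolding correlation_def
      using integrable_correlation[of "\<lambda>x. complex_of_real (Re (f x))" g K j]
        integrable_correlation[of "\<lambda>x. complex_of_real (Im (f x))" g K j] integrable_bounded[OF f fb] gb
      by (subst Bochner_Integration.integral_add) auto
    finally show "correlation f g j = ?c (\<lambda>x. Re (f x)) j + \<i> * ?c (\<lambda>x. Im (f x)) j" .
  qed
  have "avg (F m) (correlation f g) = avg (F m) (?c (\<lambda>x. Re (f x))) + \<i> * avg (F m) (?c (\<lambda>x. Im (f x)))" for m
    unfolding split avg_add avg_bounded_linear[OF bounded_linear_mult_right[of \<i>]] ..
  moreover have "(\<lambda>m. avg (F m) (?c (\<lambda>x. Re (f x))) + \<i> * avg (F m) (?c (\<lambda>x. Im (f x))))
      \<longlonglongrightarrow> complex_of_real (\<integral>x. Re (f x) \<partial>M) * (\<integral>x. g x \<partial>M)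
        + \<i> * (complex_of_real (\<integral>x. Im (f x) \<partial>M) * (\<integral>x. g x \<partial>M))"
    by (intro tendsto_add tendsto_mult_left mean_ergodic_real[OF erg F, where C = C and K = K] b g gb) auto
  moreover have "(\<integral>x. f x \<partial>M) = complex_of_real (\<integral>x. Re (f x) \<partial>M) + \<i> * complex_of_real (\<integral>x. Im (f x) \<partial>M)"
  proof -
    have "integrable M f"
      by (rule integrable_bounded[OF f fb])
    then show ?thesis
      by (simp add: complex_eq_iff)
  qed
  ultimately show ?thesis
    by (simp add: algebra_simps)
qed

end

subsection \<open>Mixing\<close>

lemma borel_measurable_cnj [measurable]: "cnj \<in> borel_measurable borel"
  by (intro borel_measurable_continuous_onI continuous_intros)

text \<open>The error \<open>e i\<close> does not depend on \<open>j\<close>, which justifies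
  interchanging the limits in \<open>i\<close> and \<open>j\<close>.\<close>

lemma tendsto_if_uniformly_approximated:
  fixes c :: "nat \<Rightarrow> complex"
  assumes "\<And>i. (\<lambda>j. d i j) \<longlonglongrightarrow> m i" "m \<longlonglongrightarrow> l"
    and "\<And>i j. norm (c j - d i j) \<le> e i" "e \<longlonglongrightarrow> (0::real)"
  shows "c \<longlonglongrightarrow> l"
proof (rule tendstoI)
  fix r :: real assume "r > 0"
  have "\<forall>\<^sub>F i in sequentially. dist (m i) l < r / 3 \<and> e i < r / 3"
    using tendstoD[OF assms(2), of "r / 3"] order_tendstoD(2)[OF assms(4), of "r / 3"] \<open>r > 0\<close>
    by (simp add: eventually_conj)
  then obtain i where i: "dist (m i) l < r / 3" "e i < r / 3"
    unfolding eventually_sequentially by blast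
  have "\<forall>\<^sub>F j in sequentially. dist (d i j) (m i) < r / 3"
    using tendstoD[OF assms(1), of "r / 3"] \<open>r > 0\<close> by simp
  then show "\<forall>\<^sub>F j in sequentially. dist (c j) l < r"
  proof eventually_elim
    case (elim j)
    have "dist (c j) (d i j) < r / 3"
      using assms(3)[of j i] i by (simp add: dist_norm)
    then show ?case
      using elim i dist_triangle[of "c j" l "d i j"] dist_triangle[of "d i j" l "m i"] by linarith
  qed
qed

text \<open>The hypotheses, including the factor 2, are those of the limit case of
  \<open>integrable_induct\<close>; the dominating function \<open>3 * norm (f x)\<close> is the
  resulting bound on the difference.\<close>

lemma tendsto_L1_if_dominated:
  fixes f :: "'a \<Rightarrow> complex"
  assumes s: "\<And>i. integrable M (s i)" and lim: "\<And>x. x \<in> space M \<Longrightarrow> (\<lambda>i. s i x) \<longlonglongrightarrow> f x"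
    and bound: "\<And>i x. x \<in> space M \<Longrightarrow> norm (s i x) \<le> 2 * norm (f x)" and f: "integrable M f"
  shows "(\<lambda>i. \<integral>x. norm (f x - s i x) \<partial>M) \<longlonglongrightarrow> 0"
    and "(\<lambda>i. \<integral>x. s i x \<partial>M) \<longlonglongrightarrow> (\<integral>x. f x \<partial>M)"
proof -
  have [measurable]: "f \<in> borel_measurable M" "\<And>i. s i \<in> borel_measurable M"
    using s f by auto
  have w: "integrable M (\<lambda>x. 2 * norm (f x))" "integrable M (\<lambda>x. 3 * norm (f x))"
    using f by auto
  have "(\<lambda>i. \<integral>x. norm (f x - s i x) \<partial>M) \<longlonglongrightarrow> (\<integral>x. 0 \<partial>M)"
  proof (rule integral_dominated_convergence[where w = "\<lambda>x. 3 * norm (f x)"])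
    show "AE x in M. (\<lambda>i. norm (f x - s i x)) \<longlonglongrightarrow> 0"
      using lim by (intro AE_I2) (auto intro!: tendsto_eq_intros)
    show "AE x in M. norm (norm (f x - s i x)) \<le> 3 * norm (f x)" for i
    proof (rule AE_I2)
      fix x assume "x \<in> space M"
      then show "norm (norm (f x - s i x)) \<le> 3 * norm (f x)"
        using norm_triangle_ineq4[of "f x" "s i x"] bound[of x i] by simp
    qed
  qed (use w in auto)
  then show "(\<lambda>i. \<integral>x. norm (f x - s i x) \<partial>M) \<longlonglongrightarrow> 0"
    by simp
  show "(\<lambda>i. \<integral>x. s i x \<partial>M) \<longlonglongrightarrow> (\<integral>x. f x \<partial>M)"
    by (rule integral_dominated_convergence[where w = "\<lambda>x. 2 * norm (f x)"]) (use lim bound w in auto)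
qed

context measure_preserving
begin

lemma measure_preserving_pair:
  "measure_preserving (M \<Otimes>\<^sub>M M) (\<lambda>(x, y). (T x, T y))"
proof -
  interpret P: pair_prob_space M M ..
  have T2: "(\<lambda>(x, y). (T x, T y)) \<in> M \<Otimes>\<^sub>M M \<rightarrow>\<^sub>M M \<Otimes>\<^sub>M M"
    by measurable
  have "distr (M \<Otimes>\<^sub>M M) (M \<Otimes>\<^sub>M M) (\<lambda>(x, y). (T x, T y)) = M \<Otimes>\<^sub>M M"
    using pair_measure_distr[OF measurable_T measurable_T]
    by (simp add: distr_T sigma_finite_measure_axioms)
  then have "invariant (M \<Otimes>\<^sub>M M) (\<lambda>(x, y). (T x, T y))"
    unfolding invariant_def using emeasure_distr[OF T2] by metis
  with T2 show ?thesis
    by (unfold_locales) auto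
qed

text \<open>An invariant \<open>F\<close> yields the invariant cylinder
  \<open>F \<times> space M\<close>, which has the same measure.\<close>

lemma ergodic_if_weakly_mixing:
  assumes "weakly_mixing M T"
  shows "ergodic M T"
  unfolding ergodic_def
proof (intro ballI impI)
  interpret P: pair_prob_space M M ..
  fix F assume F: "F \<in> sets M" and inv: "T -` F \<inter> space M = F"
  have "(\<lambda>(x, y). (T x, T y)) -` (F \<times> space M) \<inter> space (M \<Otimes>\<^sub>M M) = (T -` F \<inter> space M) \<times> space M"
    by (auto simp: space_pair_measure)
  then have "measure (M \<Otimes>\<^sub>M M) (F \<times> space M) = 0 \<or> measure (M \<Otimes>\<^sub>M M) (F \<times> space M) = 1"
    using assms F unfolding weakly_mixing_def ergodic_def inv by auto
  moreover have "measure (M \<Otimes>\<^sub>M M) (F \<times> space M) = measure M F"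
    using F by (simp add: measure_def emeasure_pair_measure_Times emeasure_space_1)
  ultimately show "measure M F = 0 \<or> measure M F = 1"
    by simp
qed

text \<open>Expand the squared modulus of \<open>c j - l\<close>. The averages of the squared
  modulus of \<open>c j\<close> come from ergodicity of T x T, those of the linear terms from
  ergodicity of T, and the four limits cancel.\<close>

lemma weakly_mixing_avg:
  assumes wm: "weakly_mixing M T" and F: "folner F"
    and f [measurable]: "f \<in> borel_measurable M" and fb: "\<And>x. x \<in> space M \<Longrightarrow> norm (f x) \<le> C"
    and g [measurable]: "g \<in> borel_measurable M" and gb: "\<And>x. x \<in> space M \<Longrightarrow> norm (g x) \<le> K"
  shows "(\<lambda>m. avg (F m) (\<lambda>j. (norm (correlation f g j - (\<integral>x. f x \<partial>M) * (\<integral>x. g x \<partial>M)))\<^sup>2)) \<longlonglongrightarrow> 0"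
proof -
  interpret P: pair_prob_space M M ..
  let ?T2 = "\<lambda>(x, y). (T x, T y)"
  interpret T2: measure_preserving "M \<Otimes>\<^sub>M M" ?T2
    by (rule measure_preserving_pair)
  let ?c = "correlation f g"
  define l where "l = (\<integral>x. f x \<partial>M) * (\<integral>x. g x \<partial>M)"
  note [simp] = folner_finite[OF F]
  have C: "norm (h (fst z) * cnj (h (snd z))) \<le> B * B"
    if "\<And>x. x \<in> space M \<Longrightarrow> norm (h x) \<le> B" "z \<in> space (M \<Otimes>\<^sub>M M)" for h :: "'a \<Rightarrow> complex" and B z
    using that order_trans[OF norm_ge_zero that(1)]
    by (auto simp: space_pair_measure norm_mult intro!: mult_mono)
  have prod: "(\<integral>z. a (fst z) * cnj (a (snd z)) \<partial>(M \<Otimes>\<^sub>M M)) = (\<integral>x. a x \<partial>M) * cnj (\<integral>x. a x \<partial>M)"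
    if [measurable]: "a \<in> borel_measurable M" and b: "\<And>x. x \<in> space M \<Longrightarrow> norm (a x) \<le> B"
    for a :: "'a \<Rightarrow> complex" and B
  proof -
    have "integrable (M \<Otimes>\<^sub>M M) (\<lambda>z. a (fst z) * cnj (a (snd z)))"
      by (rule T2.integrable_bounded[OF _ C[OF b]]) measurable
    from P.integral_fst'[OF this] show ?thesis
      by simp
  qed
  have pow: "(?T2 ^^ j) (x, y) = ((T ^^ j) x, (T ^^ j) y)" for j x y
    by (induction j) auto
  \<comment> \<open>Fubini separates the two variables: pairing each function with the conjugate of
    its copy in the second variable produces the squared modulus of the original
    correlation.\<close>
  have c2: "T2.correlation (\<lambda>z. f (fst z) * cnj (f (snd z))) (\<lambda>z. g (fst z) * cnj (g (snd z))) = (\<lambda>j. ?c j * cnj (?c j))"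
  proof
    fix j
    have "norm (f ((T ^^ j) x) * g x) \<le> C * K" if "x \<in> space M" for x
      unfolding norm_mult using that fb[of "(T ^^ j) x"] gb[OF that]
      by (intro mult_mono) (auto intro: order_trans[OF norm_ge_zero fb])
    from prod[of "\<lambda>x. f ((T ^^ j) x) * g x", OF _ this] have "?c j * cnj (?c j)
        = (\<integral>z. (f ((T ^^ j) (fst z)) * g (fst z)) * cnj (f ((T ^^ j) (snd z)) * g (snd z)) \<partial>(M \<Otimes>\<^sub>M M))"
      by (simp add: correlation_def)
    also have "\<dots> = T2.correlation (\<lambda>z. f (fst z) * cnj (f (snd z))) (\<lambda>z. g (fst z) * cnj (g (snd z))) j"
      unfolding T2.correlation_def
      by (rule Bochner_Integration.integral_cong) (auto simp: pow algebra_simps)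
    finally show "T2.correlation (\<lambda>z. f (fst z) * cnj (f (snd z))) (\<lambda>z. g (fst z) * cnj (g (snd z))) j = ?c j * cnj (?c j)"
      by simp
  qed
  have Cf: "norm (f (fst z) * cnj (f (snd z))) \<le> C * C"
    and Cg: "norm (g (fst z) * cnj (g (snd z))) \<le> K * K" if "z \<in> space (M \<Otimes>\<^sub>M M)" for z
    using C[of f C z, OF fb that] C[of g K z, OF gb that] by auto
  have "(\<lambda>m. avg (F m) (\<lambda>j. ?c j * cnj (?c j))) \<longlonglongrightarrow> (\<integral>x. f x \<partial>M) * cnj (\<integral>x. f x \<partial>M) * ((\<integral>x. g x \<partial>M) * cnj (\<integral>x. g x \<partial>M))"
    using T2.mean_ergodic[OF wm[unfolded weakly_mixing_def] F,
        of "\<lambda>z. f (fst z) * cnj (f (snd z))" _ "\<lambda>z. g (fst z) * cnj (g (snd z))", OF _ Cf _ Cg]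
    by (simp add: c2 prod[OF f fb] prod[OF g gb])
  then have sq: "(\<lambda>m. avg (F m) (\<lambda>j. ?c j * cnj (?c j))) \<longlonglongrightarrow> l * cnj l"
    by (simp add: l_def mult_ac)
  have lin: "(\<lambda>m. avg (F m) ?c) \<longlonglongrightarrow> l"
    unfolding l_def by (rule mean_ergodic[OF ergodic_if_weakly_mixing[OF wm] F f fb g gb])
  have "complex_of_real (avg (F m) (\<lambda>j. (norm (?c j - l))\<^sup>2))
      = avg (F m) (\<lambda>j. ?c j * cnj (?c j)) - cnj l * avg (F m) ?c - l * cnj (avg (F m) ?c) + l * cnj l" for m
  proof -
    have "complex_of_real (avg (F m) (\<lambda>j. (norm (?c j - l))\<^sup>2))
        = avg (F m) (\<lambda>j. ?c j * cnj (?c j) - cnj l * ?c j - l * cnj (?c j) + l * cnj l)"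
      unfolding avg_bounded_linear[OF bounded_linear_of_real, symmetric] complex_norm_square
      by (simp add: algebra_simps)
    then show ?thesis
      unfolding avg_add avg_diff avg_bounded_linear[OF bounded_linear_mult_right]
        avg_bounded_linear[OF bounded_linear_cnj]
      by (simp add: avg_const)
  qed
  moreover have "(\<lambda>m. avg (F m) (\<lambda>j. ?c j * cnj (?c j)) - cnj l * avg (F m) ?c - l * cnj (avg (F m) ?c) + l * cnj l)
      \<longlonglongrightarrow> l * cnj l - cnj l * l - l * cnj l + l * cnj l"
    by (intro tendsto_intros sq lin)
  ultimately have "(\<lambda>m. complex_of_real (avg (F m) (\<lambda>j. (norm (?c j - l))\<^sup>2))) \<longlonglongrightarrow> complex_of_real 0"
    by simp
  then show ?thesis
    unfolding tendsto_of_real_iff l_def .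
qed

text \<open>\<open>strongly_mixing\<close> is the case of two indicators. The extension is made in
  one factor at a time, \<open>g\<close> here and \<open>f\<close> afterwards, so that the other
  factor stays bounded and the \<open>L^1\<close> error is uniform in \<open>j\<close>.\<close>

lemma strongly_mixing_correlation_indicator:
  assumes sm: "strongly_mixing M T" and A [measurable]: "A \<in> sets M" and g: "integrable M g"
  shows "(\<lambda>j. correlation (indicator A) g j) \<longlonglongrightarrow> of_real (measure M A) * (\<integral>x. g x \<partial>M)"
  using g
proof (induction rule: integrable_induct)
  case (base B c)
  have [measurable]: "B \<in> sets M" by fact
  have "correlation (indicator A) (\<lambda>x. indicator B x *\<^sub>R c) j
      = of_real (measure M ((T ^^ j) -` A \<inter> space M \<inter> B)) * c" for j
  proof -
    have "correlation (indicator A) (\<lambda>x. indicator B x *\<^sub>R c) j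
        = (\<integral>x. indicator ((T ^^ j) -` A \<inter> space M \<inter> B) x *\<^sub>R c \<partial>M)"
      unfolding correlation_def
      by (rule Bochner_Integration.integral_cong) (auto simp: indicator_def)
    also have "\<dots> = of_real (measure M ((T ^^ j) -` A \<inter> space M \<inter> B)) * c"
      by (subst Bochner_Integration.integral_scaleR_left) (auto simp: scaleR_conv_of_real less_top[symmetric])
    finally show ?thesis .
  qed
  moreover have "(\<lambda>j. complex_of_real (measure M ((T ^^ j) -` A \<inter> space M \<inter> B)) * c)
      \<longlonglongrightarrow> of_real (measure M A * measure M B) * c"
    using sm unfolding strongly_mixing_def by (intro tendsto_intros) auto
  ultimately show ?case
    by (simp add: scaleR_conv_of_real mult_ac)
next
  case (add f g)
  have int: "integrable M (\<lambda>x. indicator A ((T ^^ j) x) * h x)" if "integrable M h" for j and h :: "'a \<Rightarrow> complex"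
    by (rule Bochner_Integration.integrable_bound[OF that]) (use that in \<open>auto simp: indicator_def\<close>)
  have "correlation (indicator A) (\<lambda>x. f x + g x) = (\<lambda>j. correlation (indicator A) f j + correlation (indicator A) g j)"
    using add int by (simp add: correlation_def distrib_left fun_eq_iff)
  then show ?case
    using tendsto_add[OF add(3) add(4)] add by (simp add: distrib_left)
next
  case (lim f s)
  have [measurable]: "f \<in> borel_measurable M" "\<And>i. s i \<in> borel_measurable M"
    using lim by auto
  note conv = tendsto_L1_if_dominated[OF lim.hyps]
  have int: "integrable M (\<lambda>x. indicator A ((T ^^ j) x) * h x)" if "integrable M h" for j and h :: "'a \<Rightarrow> complex"
    by (rule Bochner_Integration.integrable_bound[OF that]) (use that in \<open>auto simp: indicator_def\<close>)
  show ?case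
  proof (rule tendsto_if_uniformly_approximated[where d = "\<lambda>i. correlation (indicator A) (s i)"])
    show "(\<lambda>j. correlation (indicator A) (s i) j) \<longlonglongrightarrow> of_real (measure M A) * (\<integral>x. s i x \<partial>M)" for i
      by (rule lim.IH)
    show "(\<lambda>i. of_real (measure M A) * (\<integral>x. s i x \<partial>M)) \<longlonglongrightarrow> of_real (measure M A) * (\<integral>x. f x \<partial>M)"
      by (intro tendsto_mult_left conv)
    show "(\<lambda>i. \<integral>x. norm (f x - s i x) \<partial>M) \<longlonglongrightarrow> 0"
      by (rule conv)
    show "norm (correlation (indicator A) f j - correlation (indicator A) (s i) j) \<le> (\<integral>x. norm (f x - s i x) \<partial>M)" for i j
    proof -
      have "correlation (indicator A) f j - correlation (indicator A) (s i) j
          = (\<integral>x. indicator A ((T ^^ j) x) * (f x - s i x) \<partial>M)"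
        using int lim by (simp add: correlation_def right_diff_distrib)
      also have "norm \<dots> \<le> (\<integral>x. norm (indicator A ((T ^^ j) x) * (f x - s i x)) \<partial>M)"
        by (rule integral_norm_bound)
      also have "\<dots> \<le> (\<integral>x. norm (f x - s i x) \<partial>M)"
        using lim int by (intro integral_mono integrable_norm) (auto simp: norm_mult indicator_def)
      finally show ?thesis .
    qed
  qed
qed

text \<open>Second stage of the extension: with \<open>g\<close> bounded,
  \<open>norm_correlation_le\<close> controls the error of approximating \<open>f\<close>.\<close>

lemma strongly_mixing_correlation:
  assumes sm: "strongly_mixing M T" and f: "integrable M f"
    and g [measurable]: "g \<in> borel_measurable M" and gb: "\<And>x. x \<in> space M \<Longrightarrow> norm (g x) \<le> K"
  shows "(\<lambda>j. correlation f g j) \<longlonglongrightarrow> (\<integral>x. f x \<partial>M) * (\<integral>x. g x \<partial>M)"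
  using f
proof (induction rule: integrable_induct)
  case (base B c)
  have "correlation (\<lambda>x. indicator B x *\<^sub>R c) g = (\<lambda>j. c * correlation (indicator B) g j)"
    by (simp add: correlation_def scaleR_conv_of_real mult_ac fun_eq_iff of_real_indicator)
  moreover have "(\<lambda>j. c * correlation (indicator B) g j) \<longlonglongrightarrow> c * (of_real (measure M B) * (\<integral>x. g x \<partial>M))"
    by (intro tendsto_mult_left strongly_mixing_correlation_indicator sm base integrable_bounded[OF g gb])
  ultimately show ?case
    using base by (simp add: scaleR_conv_of_real mult_ac)
next
  case (add f h)
  have int: "integrable M (\<lambda>x. u ((T ^^ j) x) * g x)" if "integrable M u" for j and u :: "'a \<Rightarrow> complex"
    using that g gb by (rule integrable_correlation)
  have "correlation (\<lambda>x. f x + h x) g = (\<lambda>j. correlation f g j + correlation h g j)"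
    using add int by (simp add: correlation_def distrib_right fun_eq_iff)
  then show ?case
    using tendsto_add[OF add(3) add(4)] add by (simp add: distrib_right)
next
  case (lim f s)
  have [measurable]: "f \<in> borel_measurable M" "\<And>i. s i \<in> borel_measurable M"
    using lim by auto
  note conv = tendsto_L1_if_dominated[OF lim.hyps]
  have int: "integrable M (\<lambda>x. u ((T ^^ j) x) * g x)" if "integrable M u" for j and u :: "'a \<Rightarrow> complex"
    using that g gb by (rule integrable_correlation)
  show ?case
  proof (rule tendsto_if_uniformly_approximated[where d = "\<lambda>i. correlation (s i) g"])
    show "(\<lambda>j. correlation (s i) g j) \<longlonglongrightarrow> (\<integral>x. s i x \<partial>M) * (\<integral>x. g x \<partial>M)" for i
      by (rule lim.IH)
    show "(\<lambda>i. (\<integral>x. s i x \<partial>M) * (\<integral>x. g x \<partial>M)) \<longlonglongrightarrow> (\<integral>x. f x \<partial>M) * (\<integral>x. g x \<partial>M)"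
      by (intro tendsto_mult_right conv)
    show "(\<lambda>i. K * (\<integral>x. norm (f x - s i x) \<partial>M)) \<longlonglongrightarrow> 0"
      by (intro tendsto_mult_right_zero conv)
    show "norm (correlation f g j - correlation (s i) g j) \<le> K * (\<integral>x. norm (f x - s i x) \<partial>M)" for i j
    proof -
      have "correlation f g j - correlation (s i) g j = correlation (\<lambda>x. f x - s i x) g j"
        using int lim by (simp add: correlation_def left_diff_distrib)
      also have "norm \<dots> \<le> K * (\<integral>x. norm (f x - s i x) \<partial>M)"
        using lim by (intro norm_correlation_le gb) auto
      finally show ?thesis .
    qed
  qed
qed

end

subsection \<open>Fourier coefficients on the torus\<close>

definition chr :: "int ^ 'n \<Rightarrow> real ^ 'n \<Rightarrow> complex" where
  "chr k x = cis (2 * pi * (\<Sum>i\<in>UNIV. of_int (k $ i) * x $ i))"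

lemma norm_chr [simp]: "norm (chr k x) = 1"
  by (simp add: chr_def)

lemma chr_0 [simp]: "chr 0 x = 1"
  by (simp add: chr_def)

lemma chr_add: "chr (k + l) x = chr k x * chr l x"
  by (simp add: chr_def cis_mult sum.distrib algebra_simps)

lemma continuous_on_chr: "continuous_on A (chr k)"
  unfolding chr_def by (intro continuous_intros)

lemma borel_measurable_chr [measurable]: "chr k \<in> borel_measurable borel"
  by (rule borel_measurable_continuous_onI[OF continuous_on_chr])

lemma cis_add_int_turns: "cis (2 * pi * (t + of_int m)) = cis (2 * pi * t)"
  by (simp add: distrib_left flip: cis_mult)

text \<open>Points are row vectors and frequencies column vectors, so \<open>C\<close> moves across
  the pairing without a transpose. The integer parts removed by \<open>frac\<close> change the phase
  only by whole turns.\<close>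

lemma chr_T_mat: "chr k (T_mat C x) = chr (C *v k) x"
proof -
  define y where "y = x v* real_mat C"
  have "(\<Sum>i\<in>UNIV. of_int (k $ i) * y $ i)
      = (\<Sum>i\<in>UNIV. of_int (k $ i) * T_mat C x $ i) + of_int (\<Sum>i\<in>UNIV. k $ i * \<lfloor>y $ i\<rfloor>)"
    by (simp add: T_mat_def y_def frac_def algebra_simps flip: sum.distrib)
  then have "chr k (T_mat C x) = cis (2 * pi * (\<Sum>i\<in>UNIV. of_int (k $ i) * y $ i))"
    by (simp only: chr_def cis_add_int_turns)
  also have "(\<Sum>i\<in>UNIV. of_int (k $ i) * y $ i)
      = (\<Sum>i\<in>UNIV. \<Sum>j\<in>UNIV. of_int (k $ i) * (of_int (C $ j $ i) * x $ j))"
    by (simp add: y_def vector_matrix_mult_def real_mat_def sum_distrib_left mult.commute)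
  also have "\<dots> = (\<Sum>j\<in>UNIV. of_int ((C *v k) $ j) * x $ j)"
    by (subst sum.swap) (simp add: matrix_vector_mult_def sum_distrib_left mult_ac)
  finally show ?thesis by (simp add: chr_def)
qed

lemma torus_set_borel [measurable]: "torus_set \<in> sets borel"
proof -
  have "torus_set = {x :: real ^ 'n. \<forall>i\<in>UNIV. 0 \<le> x $ i \<and> x $ i < 1}"
    by (simp add: torus_set_def)
  also have "\<dots> \<in> sets borel"
    by measurable
  finally show ?thesis .
qed

lemma space_torus [simp]: "space torus = torus_set"
  by (simp add: torus_def space_restrict_space)

lemma measurable_torusI: "f \<in> borel \<rightarrow>\<^sub>M N \<Longrightarrow> f \<in> torus \<rightarrow>\<^sub>M N"
  unfolding torus_def by (rule measurable_restrict_space1)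

lemma T_mat_torus: "T_mat C x \<in> torus_set"
  by (simp add: T_mat_def torus_set_def frac_ge_0 frac_lt_1)

lemma borel_measurable_vec:
  fixes f :: "'a \<Rightarrow> 'b::euclidean_space ^ 'n"
  assumes "\<And>i. (\<lambda>x. f x $ i) \<in> borel_measurable M"
  shows "f \<in> borel_measurable M"
proof (subst borel_measurable_euclidean_space, intro ballI)
  fix b :: "'b ^ 'n" assume "b \<in> Basis"
  then obtain i u where "b = axis i u"
    by (auto simp: Basis_vec_def)
  then show "(\<lambda>x. f x \<bullet> b) \<in> borel_measurable M"
    using assms[of i] by (simp add: inner_axis)
qed

lemma T_mat_measurable: "T_mat C \<in> torus \<rightarrow>\<^sub>M torus"
proof -
  have "T_mat C \<in> borel_measurable borel"
    unfolding T_mat_def frac_def vector_matrix_mult_def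
    by (rule borel_measurable_vec) simp
  then show ?thesis
    unfolding torus_def by (intro measurable_restrict_space3) (auto simp: T_mat_torus)
qed

section \<open>Trigonometric polynomials and uniqueness of Fourier coefficients\<close>

inductive trig_poly :: "(real ^ 'n \<Rightarrow> complex) \<Rightarrow> bool" where
  monom: "trig_poly (\<lambda>x. c * chr k x)"
| add: "trig_poly f \<Longrightarrow> trig_poly g \<Longrightarrow> trig_poly (\<lambda>x. f x + g x)"

lemma trig_poly_mult:
  assumes "trig_poly f" "trig_poly g"
  shows "trig_poly (\<lambda>x. f x * g x)"
  using assms(1)
proof induction
  case (monom c k)
  show ?case
    using assms(2)
  proof induction
    case (monom d l)
    have "(\<lambda>x. c * chr k x * (d * chr l x)) = (\<lambda>x. (c * d) * chr (k + l) x)"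
      by (simp add: chr_add mult_ac fun_eq_iff)
    then show ?case by (simp only: trig_poly.monom)
  qed (simp only: distrib_left trig_poly.add)
qed (simp only: distrib_right trig_poly.add)

lemma trig_poly_const: "trig_poly (\<lambda>x. c)"
  using trig_poly.monom[of c 0] by simp

lemma trig_poly_sum: "finite S \<Longrightarrow> (\<And>i. i \<in> S \<Longrightarrow> trig_poly (f i)) \<Longrightarrow> trig_poly (\<lambda>x. \<Sum>i\<in>S. f i x)"
  by (induction rule: finite_induct) (auto intro: trig_poly_const trig_poly.add)

text \<open>Embeds the torus in C^n, where its image is compact and where trigonometric polynomials
  arise from ordinary polynomials, as Stone-Weierstrass requires.\<close>

definition circle_coords :: "real ^ 'n \<Rightarrow> complex ^ 'n" where
  "circle_coords x = (\<chi> i. cis (2 * pi * x $ i))"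

lemma chr_axis: "chr (axis i m) x = cis (2 * pi * of_int m * x $ i)"
proof -
  have "(\<Sum>j\<in>UNIV. of_int (axis i m $ j) * x $ j) = of_int m * x $ i"
    by (simp add: axis_def if_distrib[of of_int] if_distrib[of "\<lambda>z. z * _"] cong: if_cong)
  then show ?thesis by (simp add: chr_def mult.assoc)
qed

text \<open>The real coordinates of \<open>circle_coords x\<close> are cosines and sines of
  \<open>2 * pi * x $ i\<close>, combinations by Euler of the characters with frequency 1 and -1 on
  axis \<open>i\<close>; products of characters are characters.\<close>

lemma trig_poly_real_polynomial:
  fixes p :: "complex ^ 'n \<Rightarrow> real"
  assumes "real_polynomial_function p"
  shows "trig_poly (\<lambda>x. complex_of_real (p (circle_coords x)))"
  using assms
proof induction
  case (linear f)
  then interpret f: bounded_linear f .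
  have Re: "complex_of_real (cos t) = (1 / 2) * cis t + (1 / 2) * cis (- t)"
    and Im: "complex_of_real (sin t) = (- \<i> / 2) * cis t + (\<i> / 2) * cis (- t)" for t
    by (simp_all add: complex_eq_iff)
  have comp: "trig_poly (\<lambda>x. complex_of_real (circle_coords x \<bullet> b))" if "b \<in> Basis" for b :: "complex ^ 'n"
  proof -
    from that obtain i u where u: "u \<in> Basis" and b: "b = axis i u"
      by (auto simp: Basis_vec_def)

    show ?thesis
    proof (cases "u = 1")
      case True
      then have "complex_of_real (circle_coords x \<bullet> b) = (1 / 2) * chr (axis i 1) x + (1 / 2) * chr (axis i (-1)) x" for x
        by (simp add: b inner_axis circle_coords_def Re chr_axis)
      then show ?thesis
        by (simp only: trig_poly.intros)
    next
      case False
      then have "u = \<i>" using u by (simp add: Basis_complex_def)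
      then have "complex_of_real (circle_coords x \<bullet> b) = (- \<i> / 2) * chr (axis i 1) x + (\<i> / 2) * chr (axis i (-1)) x" for x
        by (simp add: b inner_axis circle_coords_def Im chr_axis)
      then show ?thesis
        by (simp only: trig_poly.intros)
    qed
  qed
  have f_eq: "f z = (\<Sum>b\<in>Basis. (z \<bullet> b) * f b)" for z
    by (subst euclidean_representation[of z, symmetric]) (simp only: f.sum f.scaleR real_scaleR_def)
  have "complex_of_real (f (circle_coords x)) = (\<Sum>b\<in>Basis. complex_of_real (circle_coords x \<bullet> b) * complex_of_real (f b))" for x :: "real ^ 'n"
    by (subst f_eq) (simp only: of_real_sum of_real_mult)
  moreover have "trig_poly (\<lambda>x :: real ^ 'n. \<Sum>b\<in>Basis. complex_of_real (circle_coords x \<bullet> b) * complex_of_real (f b))"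
    by (intro trig_poly_sum finite_Basis trig_poly_mult comp trig_poly_const)
  ultimately show ?case by simp
next
  case (add f g)
  then show ?case by (simp add: trig_poly.add)
next
  case (mult f g)
  then show ?case by (simp add: trig_poly_mult)
qed (rule trig_poly_const)

lemma continuous_on_circle_coords: "continuous_on A circle_coords"
  unfolding circle_coords_def by (intro continuous_intros)

lemma circle_coords_measurable [measurable]: "circle_coords \<in> borel_measurable borel"
  by (rule borel_measurable_continuous_onI[OF continuous_on_circle_coords])

text \<open>A Borel left inverse of \<open>cis (2 * pi * t)\<close> on \<open>0 \<le> t < 1\<close>; the clamping only serves to make
  \<open>arccos\<close> continuous on the whole line.\<close>

definition turn :: "complex \<Rightarrow> real" where
  "turn z = (let a = arccos (max (-1) (min 1 (Re z))) / (2 * pi) in if Im z \<ge> 0 then a else 1 - a)"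

lemma turn_measurable [measurable]: "turn \<in> borel_measurable borel"
proof -
  have [measurable]: "(\<lambda>z. arccos (max (-1) (min 1 (Re z)))) \<in> borel_measurable borel"
    by (intro borel_measurable_continuous_onI continuous_intros) auto
  show ?thesis
    unfolding turn_def Let_def by measurable
qed

lemma turn_cis:
  assumes "0 \<le> t" "t < 1"
  shows "turn (cis (2 * pi * t)) = t"
proof -
  have clamp: "max (-1) (min 1 (cos u)) = cos u" for u :: real
    by (simp add: max_absorb2 min_absorb2)
  show ?thesis
  proof (cases "t \<le> 1 / 2")
    case True
    then have "0 \<le> 2 * pi * t" "2 * pi * t \<le> pi"
      using assms by auto
    then show ?thesis
      by (simp add: turn_def clamp sin_ge_zero arccos_cos)
  next
    case False
    have "sin (2 * pi * t) < 0"
      using False assms by (intro sin_lt_zero) auto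
    moreover have "cos (2 * pi * t) = cos (2 * pi * (1 - t))"
      by (simp add: algebra_simps cos_diff)
    moreover have "arccos (cos (2 * pi * (1 - t))) = 2 * pi * (1 - t)"
    proof (rule arccos_cos)
      have "pi * (2 * (1 - t)) \<le> pi * 1"
        using False by (intro mult_left_mono) auto
      then show "2 * pi * (1 - t) \<le> pi" by (simp add: mult_ac)
    qed (use assms in auto)
    ultimately show ?thesis
      by (simp add: turn_def clamp)
  qed
qed

text \<open>Agreement spreads from characters to trigonometric polynomials, by Stone-Weierstrass to
  continuous functions of \<open>circle_coords x\<close>, and by approximating indicators to closed
  sets. So the images in C^n coincide, and a Borel inverse brings this back to the torus.\<close>

lemma fourier_uniqueness:
  fixes M N :: "(real ^ 'n) measure"
  assumes M: "prob_space M" "sets M = sets torus" and N: "prob_space N" "sets N = sets torus"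
    and eq: "\<And>k. (\<integral>x. chr k x \<partial>M) = (\<integral>x. chr k x \<partial>N)"
  shows "M = N"
proof -
  interpret M: prob_space M by fact
  interpret N: prob_space N by fact
  have sp: "space M = torus_set" "space N = torus_set"
    using sets_eq_imp_space_eq[OF M(2)] sets_eq_imp_space_eq[OF N(2)] by simp_all
  have meas: "f \<in> borel_measurable M" "f \<in> borel_measurable N" if "f \<in> borel_measurable borel"
    for f :: "real ^ 'n \<Rightarrow> 'b::topological_space"
    using measurable_torusI[OF that] M(2) N(2) by (simp_all cong: measurable_cong_sets)
  have trig: "integrable M f \<and> integrable N f \<and> (\<integral>x. f x \<partial>M) = (\<integral>x. f x \<partial>N)" if "trig_poly f" for f
    using that
  proof induction
    case (monom c k)
    have "integrable M (chr k)" "integrable N (chr k)"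
      by (auto intro!: M.integrable_const_bound[where B = 1] N.integrable_const_bound[where B = 1] meas)
    then show ?case using eq[of k] by simp
  next
    case (add f g)
    then show ?case by auto
  qed
  \<comment> \<open>The closed cube replaces the non-compact \<open>torus_set\<close>; the added
    faces contribute no new points to the image.\<close>
  define K where "K = circle_coords ` cbox (0 :: real ^ 'n) 1"
  have K: "compact K"
    unfolding K_def by (intro compact_continuous_image continuous_on_circle_coords compact_cbox)
  have in_K: "circle_coords x \<in> K" if "x \<in> torus_set" for x
    using that by (auto simp: K_def torus_set_def mem_box_cart less_imp_le)
  have cont: "(\<integral>x. h (circle_coords x) \<partial>M) = (\<integral>x. h (circle_coords x) \<partial>N)"
    if h: "continuous_on UNIV h" for h :: "complex ^ 'n \<Rightarrow> real"
  proof -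
    have hm: "(\<lambda>x. h (circle_coords x)) \<in> borel_measurable borel"
      using borel_measurable_continuous_onI[OF h] by measurable
    have "bounded (h ` K)"
      using compact_continuous_image[OF continuous_on_subset[OF h] K] compact_imp_bounded by blast
    then obtain B where B: "\<And>z. z \<in> K \<Longrightarrow> norm (h z) \<le> B"
      unfolding bounded_iff by auto
    have hi: "integrable M (\<lambda>x. h (circle_coords x))" "integrable N (\<lambda>x. h (circle_coords x))"
      using B in_K by (auto intro!: M.integrable_const_bound[where B = B] N.integrable_const_bound[where B = B] meas[OF hm]
          AE_I2 simp: sp)
    have "\<bar>(\<integral>x. h (circle_coords x) \<partial>M) - (\<integral>x. h (circle_coords x) \<partial>N)\<bar> \<le> e" if "e > 0" for e
    proof -
      obtain p where p: "real_polynomial_function p" "\<And>z. z \<in> K \<Longrightarrow> \<bar>h z - p z\<bar> < e / 2"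
        using Stone_Weierstrass_real_polynomial_function[OF K continuous_on_subset[OF h], of "e / 2"] \<open>e > 0\<close> by auto
      let ?p = "\<lambda>x. p (circle_coords x)"
      have "trig_poly (\<lambda>x. complex_of_real (?p x))"
        by (rule trig_poly_real_polynomial[OF p(1)])
      from trig[OF this] have pi: "integrable M ?p" "integrable N ?p" "(\<integral>x. ?p x \<partial>M) = (\<integral>x. ?p x \<partial>N)"
        by (auto simp: complex_of_real_integrable_eq)
      have M': "\<bar>(\<integral>x. h (circle_coords x) \<partial>M) - (\<integral>x. ?p x \<partial>M)\<bar> \<le> e / 2"
      proof -
        have "\<bar>\<integral>x. h (circle_coords x) - ?p x \<partial>M\<bar> \<le> (\<integral>x. \<bar>h (circle_coords x) - ?p x\<bar> \<partial>M)"
          by (rule integral_abs_bound)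
        also have "\<dots> \<le> (\<integral>x. e / 2 \<partial>M)"
          using hi pi p(2) in_K by (intro integral_mono) (auto simp: sp less_imp_le)
        finally show ?thesis using hi pi by (simp add: M.prob_space)
      qed
      have N': "\<bar>(\<integral>x. h (circle_coords x) \<partial>N) - (\<integral>x. ?p x \<partial>N)\<bar> \<le> e / 2"
      proof -
        have "\<bar>\<integral>x. h (circle_coords x) - ?p x \<partial>N\<bar> \<le> (\<integral>x. \<bar>h (circle_coords x) - ?p x\<bar> \<partial>N)"
          by (rule integral_abs_bound)
        also have "\<dots> \<le> (\<integral>x. e / 2 \<partial>N)"
          using hi pi p(2) in_K by (intro integral_mono) (auto simp: sp less_imp_le)
        finally show ?thesis using hi pi by (simp add: N.prob_space)
      qed
      show ?thesis using M' N' pi(3) by linarith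
    qed
    then have "\<bar>(\<integral>x. h (circle_coords x) \<partial>M) - (\<integral>x. h (circle_coords x) \<partial>N)\<bar> \<le> 0"
      by (rule field_le_epsilon[of _ 0, simplified])
    then show ?thesis by simp
  qed
  let ?DM = "distr M borel circle_coords" and ?DN = "distr N borel circle_coords"
  note cm = meas[OF circle_coords_measurable]
  have "?DM = ?DN"
  proof (rule measure_eqI_generator_eq[where E = "Collect closed" and \<Omega> = UNIV and A = "\<lambda>_. UNIV"])
    fix S :: "(complex ^ 'n) set" assume "S \<in> Collect closed"
    then have S: "closed S" by simp
    show "emeasure ?DM S = emeasure ?DN S"
    \<comment> \<open>\<open>infdist z {}\<close> is 0 by convention, so the functions
      \<open>h n\<close> below would tend to 1 instead of to the indicator of the empty set.\<close>
    proof (cases "S = {}")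
      case False
      have [measurable]: "S \<in> sets borel" using S by auto
      define h where "h n z = max 0 (1 - real n * infdist z S)" for n z
      have hc: "continuous_on UNIV (h n)" for n
        unfolding h_def by (intro continuous_intros)
      have hm: "(\<lambda>x. h n (circle_coords x)) \<in> borel_measurable borel" for n
        using borel_measurable_continuous_onI[OF hc] by measurable
      have sm: "(\<lambda>x. indicat_real S (circle_coords x)) \<in> borel_measurable borel"
        by measurable
      have lim: "(\<lambda>n. h n z) \<longlonglongrightarrow> indicat_real S z" for z
      proof (cases "z \<in> S")
        case True
        then show ?thesis by (simp add: h_def)
      next
        case False
        then have pos: "infdist z S > 0"
          using infdist_pos_not_in_closed S \<open>S \<noteq> {}\<close> by blast
        then obtain m where m: "1 < real m * infdist z S"
          using reals_Archimedean3 by blast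
        have "\<forall>\<^sub>F n in sequentially. h n z = 0"
          unfolding eventually_sequentially
        proof (intro exI allI impI)
          fix n assume "m \<le> n"
          then have "real m * infdist z S \<le> real n * infdist z S"
            using pos by (intro mult_right_mono) auto
          then show "h n z = 0" using m by (simp add: h_def)
        qed
        then show ?thesis using False by (simp add: tendsto_eventually)
      qed
      have hb: "norm (h n z) \<le> 1" for n z
        by (simp add: h_def infdist_nonneg)
      have "(\<lambda>n. \<integral>x. h n (circle_coords x) \<partial>M) \<longlonglongrightarrow> (\<integral>x. indicat_real S (circle_coords x) \<partial>M)"
        by (rule integral_dominated_convergence[where w = "\<lambda>_. 1"]) (use hb lim meas[OF hm] meas[OF sm] in auto)
      moreover have "(\<lambda>n. \<integral>x. h n (circle_coords x) \<partial>N) \<longlonglongrightarrow> (\<integral>x. indicat_real S (circle_coords x) \<partial>N)"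
        by (rule integral_dominated_convergence[where w = "\<lambda>_. 1"]) (use hb lim meas[OF hm] meas[OF sm] in auto)
      ultimately have "(\<integral>x. indicat_real S (circle_coords x) \<partial>M) = (\<integral>x. indicat_real S (circle_coords x) \<partial>N)"
        unfolding cont[OF hc] by (rule LIMSEQ_unique)
      moreover have "(\<integral>x. indicat_real S (circle_coords x) \<partial>M) = measure ?DM S"
        using integral_distr[OF cm(1), of "indicat_real S"] by simp
      moreover have "(\<integral>x. indicat_real S (circle_coords x) \<partial>N) = measure ?DN S"
        using integral_distr[OF cm(2), of "indicat_real S"] by simp
      ultimately show ?thesis
        using M.prob_space_distr[OF cm(1)] N.prob_space_distr[OF cm(2)]
        by (simp add: prob_space.axioms(1) finite_measure.emeasure_eq_measure prob_space_def)
    qed simp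
  next
    show "emeasure ?DM UNIV \<noteq> \<infinity>"
      using M.prob_space_distr[OF cm(1)] prob_space.axioms(1) finite_measure.emeasure_finite by (metis infinity_ennreal_def)
  qed (auto simp: Int_stable_def borel_eq_closed)
  show ?thesis
  proof (rule measure_eqI)
    fix F assume F: "F \<in> sets M"
    then obtain F0 where F0 [measurable]: "F0 \<in> sets borel" and FF: "F = F0 \<inter> torus_set"
      unfolding M(2) torus_def by (auto simp: sets_restrict_space)
    \<comment> \<open>A Borel left inverse of \<open>circle_coords\<close> on
      \<open>torus_set\<close>, which exhibits every measurable \<open>F\<close> as the preimage of
      a Borel set of C^n.\<close>
    define \<Psi> where "\<Psi> z = (\<chi> i. turn (z $ i))" for z :: "complex ^ 'n"
    have [measurable]: "\<Psi> \<in> borel_measurable borel"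
      unfolding \<Psi>_def
      by (rule borel_measurable_vec)
        (simp add: measurable_compose[OF borel_measurable_continuous_onI turn_measurable] continuous_on_component)
    have inv: "\<Psi> (circle_coords x) = x" if "x \<in> torus_set" for x
      using that by (simp add: \<Psi>_def circle_coords_def torus_set_def vec_eq_iff turn_cis)
    define G where "G = \<Psi> -` F0"
    have G [measurable]: "G \<in> sets borel"
      unfolding G_def using measurable_sets[of \<Psi> borel borel F0] by simp
    have "circle_coords -` G \<inter> torus_set = F"
      unfolding FF G_def using inv by auto
    then have "emeasure M F = emeasure ?DM G" "emeasure N F = emeasure ?DN G"
      using cm G by (simp_all add: emeasure_distr sp)
    then show "emeasure M F = emeasure N F"
      using \<open>?DM = ?DN\<close> by simp
  qed (simp add: M(2) N(2))
qed

section \<open>Fourier coefficients of Haar measure\<close>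

lemma borel_measurable_cis [measurable]: "cis \<in> borel_measurable borel"
  by (intro borel_measurable_continuous_onI continuous_intros)

lemma cis_sum: "finite S \<Longrightarrow> cis (\<Sum>i\<in>S. f i) = (\<Prod>i\<in>S. cis (f i))"
  by (induction rule: finite_induct) (simp_all flip: cis_mult)

lemma integral_cis_period:
  assumes "m \<noteq> 0"
  shows "(\<integral>t. indicator {0..<1} t *\<^sub>R cis (2 * pi * (of_int m * t)) \<partial>lborel) = 0"
proof -
  define F where "F t = cis (2 * pi * (of_int m * t)) / (\<i> * (2 * pi * of_int m))" for t
  have deriv: "(F has_vector_derivative cis (2 * pi * (of_int m * t))) (at t within {0..1})" for t
    unfolding F_def has_vector_derivative_def using assms
    by (auto intro!: derivative_eq_intros simp: scaleR_conv_of_real field_simps)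
  \<comment> \<open>The fundamental theorem of calculus is applied on a closed interval; the added
    endpoint is a null set.\<close>
  have "(\<integral>t. indicator {0..<1} t *\<^sub>R cis (2 * pi * (of_int m * t)) \<partial>lborel)
      = (\<integral>t. indicator {0..1} t *\<^sub>R cis (2 * pi * (of_int m * t)) \<partial>lborel)"
    using AE_lborel_singleton[of "1 :: real"]
    by (intro integral_cong_AE) (measurable, auto simp: indicator_def elim!: eventually_mono)
  also have "\<dots> = F 1 - F 0"
    by (rule integral_FTC_Icc) (auto intro!: deriv continuous_intros)
  also have "\<dots> = 0"
    by (simp add: F_def)
  finally show ?thesis .
qed

text \<open>The half-open cube is squeezed between the open and the closed unit cube, both of volume
  1.\<close>

lemma prob_space_haar_torus: "prob_space (haar_torus :: (real ^ 'n) measure)"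
proof
  have one: "1 \<bullet> b = 1" if "b \<in> Basis" for b :: "real ^ 'n"
    using that by (auto simp: Basis_vec_def inner_axis)
  have unit: "emeasure lborel (box 0 (1 :: real ^ 'n)) = 1" "emeasure lborel (cbox 0 (1 :: real ^ 'n)) = 1"
    using one by (simp_all add: emeasure_lborel_box_eq emeasure_lborel_cbox_eq prod.neutral)
  have "box 0 1 \<subseteq> (torus_set :: (real ^ 'n) set)" "(torus_set :: (real ^ 'n) set) \<subseteq> cbox 0 1"
    by (auto simp: torus_set_def mem_box_cart less_imp_le)
  then have "emeasure lborel (torus_set :: (real ^ 'n) set) = 1"
    using emeasure_mono[of "box 0 1" "torus_set :: (real ^ 'n) set" lborel]
      emeasure_mono[of "torus_set :: (real ^ 'n) set" "cbox 0 1" lborel] unit by auto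
  then show "emeasure haar_torus (space haar_torus :: (real ^ 'n) set) = 1"
    by (simp add: haar_torus_def emeasure_restrict_space space_restrict_space)
qed

lemma sets_haar_torus: "sets haar_torus = sets torus"
  unfolding haar_torus_def torus_def by (rule sets_restrict_space_cong) simp

text \<open>The character and the indicator of the cube both factor over the coordinates, so the
  integral is a product of integrals over one period; a coordinate with nonzero frequency makes it
  vanish.\<close>

lemma integral_chr_haar_torus:
  fixes k :: "int ^ 'n"
  assumes "k \<noteq> 0"
  shows "(\<integral>x. chr k x \<partial>haar_torus) = 0"
proof -
  \<comment> \<open>\<open>lborel\<close> is a product indexed by basis vectors, while
    \<open>k\<close> is indexed by \<open>'n\<close>; \<open>m\<close> carries the frequencies over
    to \<open>Basis\<close>.\<close>
  define m where "m b = (\<Sum>i\<in>UNIV. k $ i * (if b = axis i (1 :: real) then 1 else 0))" for b :: "real ^ 'n"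
  have m: "m (axis i 1) = k $ i" for i
    by (simp add: m_def axis_eq_axis if_distrib cong: if_cong)
  have Basis: "(Basis :: (real ^ 'n) set) = (\<lambda>i. axis i 1) ` UNIV"
    by (auto simp: Basis_vec_def)
  have inj: "inj (\<lambda>i :: 'n. axis i (1 :: real))"
    by (simp add: inj_on_def axis_eq_axis)
  let ?g = "\<lambda>b t. indicator {0..<1} t *\<^sub>R cis (2 * pi * (of_int (m b) * t))"
  have prod: "indicator torus_set x *\<^sub>R chr k x = (\<Prod>b\<in>Basis. ?g b (x \<bullet> b))" for x
  proof -
    have "(\<Prod>b\<in>Basis. ?g b (x \<bullet> b)) = (\<Prod>i\<in>UNIV. indicator {0..<1} (x $ i) *\<^sub>R cis (2 * pi * (of_int (k $ i) * x $ i)))"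
      unfolding Basis by (subst prod.reindex[OF inj]) (simp add: m inner_axis)
    also have "\<dots> = complex_of_real (\<Prod>i\<in>UNIV. indicator {0..<1} (x $ i)) * (\<Prod>i\<in>UNIV. cis (2 * pi * (of_int (k $ i) * x $ i)))"
      by (simp add: scaleR_conv_of_real prod.distrib)
    also have "(\<Prod>i\<in>UNIV. cis (2 * pi * (of_int (k $ i) * x $ i))) = chr k x"
      by (simp add: chr_def sum_distrib_left cis_sum)
    also have "(\<Prod>i\<in>UNIV. indicat_real {0..<1} (x $ i)) = indicator torus_set x"
      by (auto simp: torus_set_def indicator_def prod_zero_iff)
    finally show ?thesis by (simp add: scaleR_conv_of_real)
  qed
  interpret P: product_sigma_finite "\<lambda>_ :: real ^ 'n. lborel :: real measure" ..
  have "(\<integral>x. chr k x \<partial>haar_torus) = (\<integral>x. indicator torus_set x *\<^sub>R chr k x \<partial>lborel)"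
    unfolding haar_torus_def by (rule integral_restrict_space) simp
  also have "\<dots> = (\<integral>f. indicator torus_set (\<Sum>b\<in>Basis. f b *\<^sub>R b) *\<^sub>R chr k (\<Sum>b\<in>Basis. f b *\<^sub>R b)
      \<partial>(\<Pi>\<^sub>M b\<in>Basis. lborel))"
    by (subst lborel_eq, subst integral_distr) simp_all
  also have "\<dots> = (\<integral>f. (\<Prod>b\<in>Basis. ?g b (f b)) \<partial>(\<Pi>\<^sub>M b\<in>Basis. lborel))"
    unfolding prod by (intro Bochner_Integration.integral_cong prod.cong refl) simp
  also have "\<dots> = (\<Prod>b\<in>Basis. \<integral>t. ?g b t \<partial>lborel)"
  proof (rule P.product_integral_prod)
    fix b :: "real ^ 'n"
    have "integrable lborel (\<lambda>t. indicator {0..1} t *\<^sub>R cis (2 * pi * (of_int (m b) * t)))"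
      by (intro borel_integrable_compact continuous_intros) auto
    then show "integrable lborel (?g b)"
      by (rule Bochner_Integration.integrable_bound) (measurable, auto simp: indicator_def)
  qed simp
  also have "\<dots> = 0"
  proof -
    obtain i where "k $ i \<noteq> 0"
      using assms by (auto simp: vec_eq_iff)
    then have "(\<integral>t. ?g (axis i 1) t \<partial>lborel) = 0"
      unfolding m by (rule integral_cis_period)
    then show ?thesis
      by (auto simp: prod_zero_iff intro!: bexI[of _ "axis i 1"])
  qed
  finally show ?thesis .
qed

lemma haar_torus_if_fourier_vanish:
  fixes M :: "(real ^ 'n) measure"
  assumes "prob_space M" "sets M = sets torus" "\<And>k. k \<noteq> 0 \<Longrightarrow> (\<integral>x. chr k x \<partial>M) = 0"
  shows "M = haar_torus"
proof (rule fourier_uniqueness)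
  interpret H: prob_space "haar_torus :: (real ^ 'n) measure"
    by (rule prob_space_haar_torus)
  show "(\<integral>x. chr k x \<partial>M) = (\<integral>x. chr k x \<partial>haar_torus)" for k
    using assms integral_chr_haar_torus[of k] H.prob_space prob_space.prob_space[OF assms(1)]
    by (cases "k = 0") auto
qed (use assms prob_space_haar_torus sets_haar_torus in auto)

subsection \<open>Rigidity\<close>

lemma det_of_int:
  "det (\<chi> i j. of_int (M $ i $ j)) = (of_int (det M) :: 'a :: comm_ring_1)"
  by (simp add: det_def)

text \<open>The mean of a function with values in the unit disc can be 1 only if the function is
  almost everywhere 1: the nonnegative \<open>1 - Re (chr k x)\<close> has integral 0. The phase is
  then a whole number of turns.\<close>

lemma AE_integer_if_integral_chr_eq_1:
  assumes "prob_space M" "sets M = sets torus" "(\<integral>x. chr k x \<partial>M) = 1"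
  shows "AE x in M. (\<Sum>i\<in>UNIV. of_int (k $ i) * x $ i) \<in> \<int>"
proof -
  interpret prob_space M by fact
  let ?s = "\<lambda>x. \<Sum>i\<in>UNIV. of_int (k $ i) * x $ i"
  have [measurable]: "chr k \<in> borel_measurable M"
    using measurable_torusI[OF borel_measurable_chr] assms(2) by (simp cong: measurable_cong_sets)
  have int: "integrable M (chr k)"
    by (rule integrable_const_bound[where B = 1]) auto
  have "(\<integral>x. 1 - Re (chr k x) \<partial>M) = 0"
    using int assms(3) by (simp add: prob_space)
  moreover have "Re (chr k x) \<le> 1" for x
    using complex_Re_le_cmod[of "chr k x"] by simp
  moreover have "integrable M (\<lambda>x. 1 - Re (chr k x))"
    using int by simp
  ultimately have "AE x in M. 1 - Re (chr k x) = 0"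
    by (subst (asm) integral_nonneg_eq_0_iff_AE) auto
  then show ?thesis
  proof eventually_elim
    case (elim x)
    then have "cos (2 * pi * ?s x) = 1"
      by (simp add: chr_def)
    then obtain n :: int where "2 * pi * ?s x = of_int n * 2 * pi"
      unfolding cos_one_2pi_int by auto
    then have "?s x = of_int n"
      by simp
    then show ?case by simp
  qed
qed

text \<open>For \<open>x\<close> in the unit cube, the entries of \<open>L x\<close> are bounded by
  sums of entries of \<open>L\<close> in absolute value. Being integers, they take finitely many
  values, and \<open>L\<close> is injective over the reals.\<close>

lemma finite_integral_points:
  fixes L :: "int ^ 'n ^ 'n"
  assumes det: "det L \<noteq> 0"
  shows "finite {x \<in> torus_set. \<forall>i. (\<Sum>j\<in>UNIV. of_int (L $ i $ j) * x $ j) \<in> \<int>}"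
proof -
  define R where "R = real_mat L"
  have "det R \<noteq> 0"
    unfolding R_def real_mat_def det_of_int using det by simp
  then have inj: "inj ((*v) R)"
    using invertible_det_nz[of R] inj_matrix_vector_mult by blast
  define N where "N = (\<Sum>i\<in>UNIV. \<Sum>j\<in>UNIV. \<bar>L $ i $ j\<bar>)"
  let ?V = "{v :: real ^ 'n. \<forall>i. v $ i \<in> of_int ` {- N..N}}"
  have "finite ?V"
  proof -
    have "?V \<subseteq> vec_lambda ` (UNIV \<rightarrow>\<^sub>E (of_int ` {- N..N} :: real set))"
    proof
      fix v assume "v \<in> ?V"
      then have "(\<lambda>i. v $ i) \<in> UNIV \<rightarrow>\<^sub>E (of_int ` {- N..N} :: real set)"
        by auto
      then show "v \<in> vec_lambda ` (UNIV \<rightarrow>\<^sub>E (of_int ` {- N..N} :: real set))"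
        by (rule image_eqI[rotated]) simp
    qed
    moreover have "finite (UNIV \<rightarrow>\<^sub>E (of_int ` {- N..N} :: real set) :: ('n \<Rightarrow> real) set)"
      by (intro finite_PiE) auto
    ultimately show ?thesis
      using finite_subset by blast
  qed
  then have "finite ((*v) R -` ?V)"
    using inj by (rule finite_vimageI)
  moreover have "{x \<in> torus_set. \<forall>i. (\<Sum>j\<in>UNIV. of_int (L $ i $ j) * x $ j) \<in> \<int>} \<subseteq> (*v) R -` ?V"
  proof (intro subsetI vimageI2 CollectI allI)
    fix x :: "real ^ 'n" and i
    assume "x \<in> {x \<in> torus_set. \<forall>i. (\<Sum>j\<in>UNIV. of_int (L $ i $ j) * x $ j) \<in> \<int>}"
    then have x: "x \<in> torus_set" and "(\<Sum>j\<in>UNIV. of_int (L $ i $ j) * x $ j) \<in> \<int>"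
      by auto
    then obtain m where m: "(\<Sum>j\<in>UNIV. of_int (L $ i $ j) * x $ j) = real_of_int m"
      by (meson Ints_cases)
    have "\<bar>real_of_int m\<bar> \<le> (\<Sum>j\<in>UNIV. \<bar>of_int (L $ i $ j) * x $ j\<bar>)"
      unfolding m[symmetric] by (rule sum_abs)
    also have "\<dots> \<le> (\<Sum>j\<in>UNIV. of_int \<bar>L $ i $ j\<bar>)"
      using x by (intro sum_mono) (auto simp: abs_mult torus_set_def less_imp_le intro!: mult_left_le)
    also have "\<dots> \<le> of_int N"
      unfolding N_def of_int_sum[symmetric] of_int_le_iff
      by (rule member_le_sum[of i UNIV "\<lambda>i. \<Sum>j\<in>UNIV. \<bar>L $ i $ j\<bar>"]) (auto intro: sum_nonneg)
    finally have "m \<in> {- N..N}" by auto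
    then show "(R *v x) $ i \<in> of_int ` {- N..N}"
      using m by (auto simp: R_def real_mat_def matrix_vector_mult_def)
  qed
  ultimately show ?thesis
    by (rule finite_subset[rotated])
qed

text \<open>If the integer matrix with rows \<open>B i *v k\<close> were singular, so would be its
  rational copy. A kernel vector of the transpose is then a nontrivial rational relation between
  these rows, which strong independence at \<open>v = k\<close> forbids.\<close>

lemma strongly_independent_det:
  fixes B :: "'n \<Rightarrow> int ^ 'n ^ 'n"
  assumes "strongly_independent B" "k \<noteq> 0"
  shows "det (\<chi> i. B i *v k) \<noteq> 0"
proof
  assume det: "det (\<chi> i. B i *v k) = 0"
  define v :: "rat ^ 'n" where "v = (\<chi> i. of_int (k $ i))"
  define L :: "rat ^ 'n ^ 'n" where "L = (\<chi> i j. of_int ((B i *v k) $ j))"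
  have "det L = 0"
    using det_of_int[of "\<chi> i. B i *v k", where 'a = rat] det by (simp add: L_def)
  then have "det (transpose L) = 0"
    by (simp add: det_transpose)
  then have "\<not> invertible (transpose L)"
    by (simp add: invertible_det_nz)
  then obtain c where c: "transpose L *v c = 0" "c \<noteq> 0"
    unfolding invertible_left_inverse matrix_left_invertible_ker by blast
  have "v \<noteq> 0"
    using assms(2) by (auto simp: v_def vec_eq_iff)
  have "rat_mat (B i) *v v = L $ i" for i
    by (simp add: L_def v_def rat_mat_def matrix_vector_mult_def vec_eq_iff)
  then have "(\<Sum>i\<in>UNIV. (c $ i) *s (rat_mat (B i) *v v)) = 0"
    using c(1) by (simp add: vec_eq_iff matrix_vector_mult_def transpose_def mult.commute)
  then have "\<forall>i. c $ i = 0"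
    using assms(1) \<open>v \<noteq> 0\<close> unfolding strongly_independent_def by blast
  then show False
    using c(2) by (simp add: vec_eq_iff)
qed

lemma chr_mpow: "chr (mpow A j *v k) x = chr k ((T_mat A ^^ j) x)"
proof (induction j arbitrary: x)
  case (Suc j)
  have "chr (mpow A (Suc j) *v k) x = chr (mpow A j *v k) (T_mat A x)"
    by (simp add: chr_T_mat mpow_def matrix_vector_mul_assoc)
  then show ?case
    by (simp add: Suc.IH funpow_swap1)
qed (simp add: mpow_def)

section \<open>The dichotomy for the Fourier coefficients of an invariant measure\<close>

locale torus_endomorphism =
  fixes A :: "int ^ 'n ^ 'n" and \<mu> :: "(real ^ 'n) measure"
  assumes prob: "prob_space \<mu>" and sets_mu: "sets \<mu> = sets torus" and invA: "invariant \<mu> (T_mat A)"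
begin

lemma space_mu: "space \<mu> = torus_set"
  using sets_eq_imp_space_eq[OF sets_mu] by simp

lemma measurable_T_mat: "T_mat C \<in> \<mu> \<rightarrow>\<^sub>M \<mu>"
  using T_mat_measurable[of C] measurable_cong_sets[OF sets_mu sets_mu] by simp

sublocale measure_preserving \<mu> "T_mat A"
proof -
  interpret prob_space \<mu> by (rule prob)
  show "measure_preserving \<mu> (T_mat A)"
    by unfold_locales (use measurable_T_mat invA in auto)
qed

lemma borel_measurable_chr_mu [measurable]: "chr k \<in> borel_measurable \<mu>"
  using measurable_torusI[OF borel_measurable_chr] sets_mu by (simp cong: measurable_cong_sets)

lemma integrable_chr: "integrable \<mu> (chr k)"
  by (rule integrable_bounded[where C = 1]) auto

definition coeff :: "int ^ 'n \<Rightarrow> complex" where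
  "coeff k = (\<integral>x. chr k x \<partial>\<mu>)"

lemma coeff_invariant:
  assumes "invariant \<mu> (T_mat C)"
  shows "coeff (C *v k) = coeff k"
proof -
  interpret C: measure_preserving \<mu> "T_mat C"
    by unfold_locales (use measurable_T_mat assms in auto)
  show ?thesis
    using C.integral_T[OF borel_measurable_chr_mu[of k]] by (simp add: coeff_def chr_T_mat)
qed

lemma correlation_chr:
  assumes "invariant \<mu> (T_mat (mpow A j + C))"
  shows "correlation (chr k) (chr (C *v k)) j = coeff k"
proof -
  have "correlation (chr k) (chr (C *v k)) j = coeff ((mpow A j + C) *v k)"
    by (simp add: correlation_def coeff_def matrix_vector_mult_add_rdistrib chr_add chr_mpow)
  then show ?thesis
    using coeff_invariant[OF assms] by simp
qed

lemma haar_or_finitely_supported: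
  assumes ind: "strongly_independent B"
    and mult: "\<And>k i. coeff k = coeff k * coeff (B i *v k)"
  shows "finitely_supported \<mu> \<or> \<mu> = haar_torus"
proof (cases "\<exists>k. k \<noteq> 0 \<and> coeff k \<noteq> 0")
  case False
  then have "\<mu> = haar_torus"
    using prob sets_mu by (intro haar_torus_if_fourier_vanish) (auto simp: coeff_def)
  then show ?thesis ..
next
  case True
  then obtain k where k: "k \<noteq> 0" "coeff k \<noteq> 0" by blast
  define L where "L = (\<chi> i. B i *v k)"
  let ?S = "{x \<in> torus_set. \<forall>i. (\<Sum>j\<in>UNIV. of_int (L $ i $ j) * x $ j) \<in> \<int>}"
  have fin: "finite ?S"
    unfolding L_def by (intro finite_integral_points strongly_independent_det ind k)
  have "?S \<in> sets borel"
    using fin by (intro finite_imp_closed borel_closed)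
  then have S: "?S \<in> sets \<mu>"
    unfolding sets_mu torus_def by (subst sets_restrict_space_iff) auto
  have "coeff (B i *v k) = 1" for i
    using mult[of k i] k(2) by simp
  then have "AE x in \<mu>. (\<Sum>j\<in>UNIV. of_int (L $ i $ j) * x $ j) \<in> \<int>" for i
    using AE_integer_if_integral_chr_eq_1[OF prob sets_mu, of "B i *v k"] by (simp add: coeff_def L_def)
  then have "AE x in \<mu>. \<forall>i. (\<Sum>j\<in>UNIV. of_int (L $ i $ j) * x $ j) \<in> \<int>"
    by (simp add: AE_all_countable)
  then have "AE x in \<mu>. x \<in> ?S"
    using AE_space by eventually_elim (auto simp: space_mu)
  then have "emeasure \<mu> ?S = 1"
    using S emeasure_eq_1_AE by blast
  then show ?thesis
    using fin S unfolding finitely_supported_def by blast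
qed

section \<open>Atoms of a mixing measure\<close>

lemma singleton_sets: "x \<in> torus_set \<Longrightarrow> {x} \<in> sets \<mu>"
  unfolding sets_mu torus_def by (subst sets_restrict_space_iff) auto

lemma finitely_supported_atom:
  assumes "finitely_supported \<mu>"
  shows "\<exists>x\<in>torus_set. measure \<mu> {x} > 0"
proof (rule ccontr)
  assume no: "\<not> ?thesis"
  obtain S where S: "finite S" "S \<in> sets \<mu>" "emeasure \<mu> S = 1"
    using assms unfolding finitely_supported_def by blast
  then have sub: "S \<subseteq> torus_set"
    using sets.sets_into_space space_mu by blast
  have "measure \<mu> S = (\<Sum>x\<in>S. measure \<mu> {x})"
    using S sub by (intro finite_measure_eq_sum_singleton) (auto intro: singleton_sets)
  also have "\<dots> = 0"
    using no sub measure_nonneg[of \<mu>] by (intro sum.neutral) (force simp: not_less intro: antisym)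
  finally show False
    using S(3) by (simp add: emeasure_eq_measure)
qed

lemma dirac_if_full_atom:
  assumes x: "x \<in> torus_set" and "measure \<mu> {x} = 1"
  shows "\<mu> = return torus x"
proof (rule measure_eqI)
  have "AE y in \<mu>. y \<in> {x}"
    using assms singleton_sets[OF x] by (simp add: prob_eq_1)
  fix F assume F: "F \<in> sets \<mu>"
  have "emeasure \<mu> F = emeasure \<mu> (if x \<in> F then space \<mu> else {})"
    using F \<open>AE y in \<mu>. y \<in> {x}\<close> sets.top[of \<mu>] by (intro emeasure_eq_AE) (auto simp: space_mu x elim!: eventually_mono)
  then show "emeasure \<mu> F = emeasure (return torus x) F"
    using F sets_mu by (simp add: emeasure_return emeasure_space_1 indicator_def)
qed (simp add: sets_mu)

lemma integral_indicator_complex: "S \<in> sets \<mu> \<Longrightarrow> (\<integral>y. indicator S y \<partial>\<mu>) = complex_of_real (measure \<mu> S)"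
proof -
  assume S: "S \<in> sets \<mu>"
  have "(\<integral>y. indicator S y \<partial>\<mu>) = (\<integral>y. complex_of_real (indicat_real S y) \<partial>\<mu>)"
    by (simp only: of_real_indicator)
  also have "\<dots> = complex_of_real (\<integral>y. indicat_real S y \<partial>\<mu>)"
    using S by (intro integral_of_real) (auto simp: less_top[symmetric])
  also have "\<dots> = complex_of_real (measure \<mu> S)"
    using sets.sets_into_space[OF S] by (simp add: Int_absorb2)
  finally show ?thesis .
qed

text \<open>The autocorrelations of an atom of mass \<open>p\<close> only take the values \<open>0\<close> and \<open>p\<close>, so they stay
  away from \<open>p\<^sup>2\<close> unless \<open>p = 1\<close>.\<close>

lemma atom_correlation:
  assumes "x \<in> torus_set"
  shows "correlation (indicator {x}) (indicator {x}) j
    = (if (T_mat A ^^ j) x = x then of_real (measure \<mu> {x}) else 0)"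
proof -
  have [measurable]: "{x} \<in> sets \<mu>"
    using assms by (rule singleton_sets)
  have "correlation (indicator {x}) (indicator {x}) j
      = (\<integral>y. (if (T_mat A ^^ j) x = x then 1 else 0) * indicator {x} y \<partial>\<mu>)"
    unfolding correlation_def by (rule Bochner_Integration.integral_cong) (auto simp: indicator_def)
  also have "\<dots> = (if (T_mat A ^^ j) x = x then of_real (measure \<mu> {x}) else 0)"
    using integral_indicator_complex[OF \<open>{x} \<in> sets \<mu>\<close>] by simp
  finally show ?thesis .
qed

text \<open>The averaged squared deviation of the autocorrelations of an atom from
  \<open>p^2\<close> tends to 0, although each term is at least \<open>e^2\<close>; hence
  \<open>e = 0\<close>, which forces full mass.\<close>

lemma dirac_if_weakly_mixing:
  assumes wm: "weakly_mixing \<mu> (T_mat A)" and F: "folner F" and fin: "finitely_supported \<mu>"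
  shows "\<exists>x\<in>torus_set. \<mu> = return torus x"
proof -
  obtain x where x: "x \<in> torus_set" and pos: "measure \<mu> {x} > 0"
    using finitely_supported_atom[OF fin] by blast
  have [measurable]: "{x} \<in> sets \<mu>"
    using x by (rule singleton_sets)
  define p where "p = measure \<mu> {x}"
  let ?I = "indicator {x} :: real ^ 'n \<Rightarrow> complex"
  have int: "(\<integral>y. ?I y \<partial>\<mu>) = of_real p"
    using integral_indicator_complex[OF \<open>{x} \<in> sets \<mu>\<close>] by (simp add: p_def)
  \<comment> \<open>The distances of \<open>p^2\<close> from 0 and from \<open>p\<close>, the two
    possible autocorrelations; as \<open>p > 0\<close>, the minimum vanishes only for
    \<open>p = 1\<close>.\<close>
  define e where "e = min (p\<^sup>2) (p * (1 - p))"
  have "p \<le> 1" by (simp add: p_def)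
  have "e\<^sup>2 \<le> (norm (correlation ?I ?I j - of_real p * of_real p))\<^sup>2" for j
  proof (rule power_mono)
    have "of_real p - of_real p * of_real p = complex_of_real (p * (1 - p))"
      by (simp add: algebra_simps)
    then show "e \<le> norm (correlation ?I ?I j - of_real p * of_real p)"
      using \<open>p \<le> 1\<close> pos unfolding atom_correlation[OF x] p_def[symmetric]
      by (auto simp: e_def norm_mult power2_eq_square abs_mult simp del: of_real_mult of_real_diff)
    show "0 \<le> e"
      using \<open>p \<le> 1\<close> pos by (simp add: e_def p_def)
  qed
  then have "e\<^sup>2 \<le> avg (F m) (\<lambda>j. (norm (correlation ?I ?I j - of_real p * of_real p))\<^sup>2)" for m
    using folner_finite[OF F, of m] sum_bounded_below[of "F m" "e\<^sup>2"]
    by (simp add: avg_def field_simps card_gt_0_iff)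
  moreover have "(\<lambda>m. avg (F m) (\<lambda>j. (norm (correlation ?I ?I j - of_real p * of_real p))\<^sup>2)) \<longlonglongrightarrow> 0"
    unfolding int[symmetric] by (rule weakly_mixing_avg[OF wm F, where C = 1 and K = 1]) (auto simp: indicator_def)
  ultimately have "e\<^sup>2 \<le> 0"
    by (intro LIMSEQ_le_const) auto
  then have "p = 1"
    using pos \<open>p \<le> 1\<close> by (auto simp: e_def min_def p_def split: if_splits)
  then show ?thesis
    using dirac_if_full_atom[OF x] x by (auto simp: p_def)
qed

text \<open>The autocorrelations of an atom lie in the closed set of the two numbers 0 and
  \<open>p\<close>, so their limit \<open>p^2\<close> does too, and a positive \<open>p\<close> must
  be 1.\<close>

lemma dirac_if_strongly_mixing:
  assumes sm: "strongly_mixing \<mu> (T_mat A)" and fin: "finitely_supported \<mu>"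
  shows "\<exists>x\<in>torus_set. \<mu> = return torus x"
proof -
  obtain x where x: "x \<in> torus_set" and pos: "measure \<mu> {x} > 0"
    using finitely_supported_atom[OF fin] by blast
  have [measurable]: "{x} \<in> sets \<mu>"
    using x by (rule singleton_sets)
  define p where "p = measure \<mu> {x}"
  let ?I = "indicator {x} :: real ^ 'n \<Rightarrow> complex"
  have int: "(\<integral>y. ?I y \<partial>\<mu>) = of_real p"
    using integral_indicator_complex[OF \<open>{x} \<in> sets \<mu>\<close>] by (simp add: p_def)
  have "integrable \<mu> ?I"
    by (rule integrable_bounded[where C = 1]) (auto simp: indicator_def)
  then have lim: "(\<lambda>j. correlation ?I ?I j) \<longlonglongrightarrow> of_real p * of_real p"
    unfolding int[symmetric] by (rule strongly_mixing_correlation[OF sm, where K = 1]) (auto simp: indicator_def)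
  have "closed {0, complex_of_real p}"
    by (simp add: finite_imp_closed)
  moreover have "\<forall>\<^sub>F j in sequentially. correlation ?I ?I j \<in> {0, complex_of_real p}"
    unfolding atom_correlation[OF x] p_def by simp
  ultimately have "complex_of_real p * of_real p \<in> {0, complex_of_real p}"
    using Lim_in_closed_set[OF _ _ sequentially_bot lim] by blast
  then have "p = 1"
    using pos by (auto simp: p_def simp flip: of_real_mult)
  then show ?thesis
    using dirac_if_full_atom[OF x] x by (auto simp: p_def)
qed

section \<open>The coefficient identity under the three kinds of mixing\<close>

lemma coeff_mult_ergodic:
  assumes "ergodic \<mu> (T_mat A)" and F: "folner F" and "upper_density F E = 1"
    and "\<And>j. j \<in> E \<Longrightarrow> invariant \<mu> (T_mat (mpow A j + C))"
  shows "coeff k = coeff k * coeff (C *v k)"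
proof (rule upper_density_one_eqI[OF F])
  show "(\<lambda>m. avg (F m) (correlation (chr k) (chr (C *v k)))) \<longlonglongrightarrow> coeff k * coeff (C *v k)"
    unfolding coeff_def by (rule mean_ergodic[OF assms(1) F, where C = 1 and K = 1]) auto
  show "norm (correlation (chr k) (chr (C *v k)) j) \<le> 1" for j
    using norm_correlation_le[OF borel_measurable_chr_mu integrable_chr borel_measurable_chr_mu, of "C *v k" 1 k j]
    by (simp add: prob_space)
qed (use assms correlation_chr in auto)

lemma coeff_mult_weakly_mixing:
  assumes "weakly_mixing \<mu> (T_mat A)" and F: "folner F" and "upper_density F E > 0"
    and "\<And>j. j \<in> E \<Longrightarrow> invariant \<mu> (T_mat (mpow A j + C))"
  shows "coeff k = coeff k * coeff (C *v k)"
proof (rule upper_density_pos_eqI[OF F])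
  show "(\<lambda>m. avg (F m) (\<lambda>j. (norm (correlation (chr k) (chr (C *v k)) j - coeff k * coeff (C *v k)))\<^sup>2)) \<longlonglongrightarrow> 0"
    unfolding coeff_def by (rule weakly_mixing_avg[OF assms(1) F, where C = 1 and K = 1]) auto
qed (use assms correlation_chr in auto)

lemma coeff_mult_strongly_mixing:
  assumes "strongly_mixing \<mu> (T_mat A)" and E: "infinite E"
    and "\<And>j. j \<in> E \<Longrightarrow> invariant \<mu> (T_mat (mpow A j + C))"
  shows "coeff k = coeff k * coeff (C *v k)"
proof -
  have "(\<lambda>j. correlation (chr k) (chr (C *v k)) j) \<longlonglongrightarrow> coeff k * coeff (C *v k)"
    unfolding coeff_def
    by (rule strongly_mixing_correlation[OF assms(1) integrable_chr, where K = 1]) auto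
  \<comment> \<open>Along the increasing enumeration of \<open>E\<close> the correlation is
    constantly \<open>coeff k\<close>, and a subsequence keeps the limit of the whole
    sequence.\<close>
  from LIMSEQ_subseq_LIMSEQ[OF this strict_mono_enumerate[OF E]]
  have "(\<lambda>n. correlation (chr k) (chr (C *v k)) (enumerate E n)) \<longlonglongrightarrow> coeff k * coeff (C *v k)"
    by (simp add: o_def)
  moreover have "correlation (chr k) (chr (C *v k)) (enumerate E n) = coeff k" for n
    using assms(3) enumerate_in_set[OF E] by (intro correlation_chr) auto
  ultimately show ?thesis
    by (simp add: LIMSEQ_const_iff)
qed

end

theorem theorem1p7:
  fixes A :: "int ^ 'n ^ 'n" and \<mu> :: "(real ^ 'n) measure"
  assumes prob: "prob_space \<mu>"
    and sets_mu: "sets \<mu> = sets torus"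
    and invA: "invariant \<mu> (T_mat A)"
  defines "cond1 \<equiv> ergodic \<mu> (T_mat A) \<and>
      (\<exists>(B :: 'n \<Rightarrow> int ^ 'n ^ 'n) F E. strongly_independent B \<and> folner F \<and>
         upper_density F E = 1 \<and>
         (\<forall>j\<in>E. \<forall>i. invariant \<mu> (T_mat (mpow A j + B i))))"
    and "cond2 \<equiv> weakly_mixing \<mu> (T_mat A) \<and>
      (\<exists>(B :: 'n \<Rightarrow> int ^ 'n ^ 'n) F E. strongly_independent B \<and> folner F \<and>
         upper_density F E > 0 \<and>
         (\<forall>j\<in>E. \<forall>i. invariant \<mu> (T_mat (mpow A j + B i))))"
    and "cond3 \<equiv> strongly_mixing \<mu> (T_mat A) \<and>
      (\<exists>(B :: 'n \<Rightarrow> int ^ 'n ^ 'n) (E :: nat set). strongly_independent B \<and> infinite E \<and>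
         (\<forall>j\<in>E. \<forall>i. invariant \<mu> (T_mat (mpow A j + B i))))"
  shows "(cond1 \<or> cond2 \<or> cond3 \<longrightarrow> finitely_supported \<mu> \<or> \<mu> = haar_torus) \<and>
         (cond2 \<or> cond3 \<longrightarrow> (\<exists>x\<in>torus_set. \<mu> = return torus x) \<or> \<mu> = haar_torus)"
proof -
  interpret torus_endomorphism A \<mu>
    using prob sets_mu invA by (rule torus_endomorphism.intro)
  have 1: "finitely_supported \<mu> \<or> \<mu> = haar_torus" if c: cond1
  proof -
    obtain B F E where "strongly_independent B" "folner F" "upper_density F E = 1"
      "\<forall>j\<in>E. \<forall>i. invariant \<mu> (T_mat (mpow A j + B i))" and "ergodic \<mu> (T_mat A)"
      using c unfolding cond1_def by blast
    then show ?thesis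
      by (intro haar_or_finitely_supported coeff_mult_ergodic[of F E]) auto
  qed
  \<comment> \<open>Finite support is kept next to the Dirac form so that this one fact serves both
    halves of the conclusion.\<close>
  have 2: "finitely_supported \<mu> \<and> (\<exists>x\<in>torus_set. \<mu> = return torus x) \<or> \<mu> = haar_torus" if c: cond2
  proof -
    obtain B F E where B: "strongly_independent B" and F: "folner F" and E: "upper_density F E > 0"
      "\<forall>j\<in>E. \<forall>i. invariant \<mu> (T_mat (mpow A j + B i))" and wm: "weakly_mixing \<mu> (T_mat A)"
      using c unfolding cond2_def by blast
    have "finitely_supported \<mu> \<or> \<mu> = haar_torus"
      using E by (intro haar_or_finitely_supported[OF B] coeff_mult_weakly_mixing[OF wm F, of E]) auto
    then show ?thesis
      using dirac_if_weakly_mixing[OF wm F] by blast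
  qed
  have 3: "finitely_supported \<mu> \<and> (\<exists>x\<in>torus_set. \<mu> = return torus x) \<or> \<mu> = haar_torus" if c: cond3
  proof -
    obtain B and E :: "nat set" where B: "strongly_independent B" and E: "infinite E"
      "\<forall>j\<in>E. \<forall>i. invariant \<mu> (T_mat (mpow A j + B i))" and sm: "strongly_mixing \<mu> (T_mat A)"
      using c unfolding cond3_def by blast
    have "finitely_supported \<mu> \<or> \<mu> = haar_torus"
      using E by (intro haar_or_finitely_supported[OF B] coeff_mult_strongly_mixing[OF sm, of E]) auto
    then show ?thesis
      using dirac_if_strongly_mixing[OF sm] by blast
  qed
  show ?thesis
    using 1 2 3 by blast
qed

end
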